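(* Let $0<\alpha\le1$ and $1\le p<\infty$. The space $W_{\Delta,b^-}^{\alpha,p}$ is separable with respect to the norm $\|\cdot\|_{W_{\Delta,b^-}^{\alpha,p}}$ given by $\|u\|_{W_{\Delta,b^-}^{\alpha,p}}^p=\|u\|_{L_\Delta^p}^p+\|{}_t^{\mathbb T}D_b^\alpha u\|_{L_\Delta^p}^p$.
   Context: Setting: $\mathbb T$ is a time scale (a nonempty closed subset of $\mathbb R$), $a,b\in\mathbb T$ with $0<a<b$, $J=[a,b]\cap\mathbb T$, $J^0=[a,b)\cap\mathbb T$, $N\in\mathbb{N}$. $\sigma(t)=\inf\{s\in\mathbb T:s>t\}$ is the forward jump operator (with $\inf\varnothing=\sup\mathbb T$), $f^\Delta$ is the delta (Hilger) derivative, and $\int\cdot\,\Delta s$ is the (Lebesgue) delta integral ($\int_c^d$ is over $[c,d)\cap\mathbb T$). $L_\Delta^p=L_\Delta^p(J^0,\mathbb R^N)$ with norm $\|f\|_{L_\Delta^p}=\left(\int_a^b|f(s)|^p\Delta s\right)^{1/p}$. Fractional operators (componentwise), $0<\alpha\le1$: $${}_a^{\mathbb T}I_t^\alpha h(t)=\int_a^t\frac{(t-\sigma(s))^{\alpha-1}}{\Gamma(\alpha)}h(s)\Delta s,\qquad {}_t^{\mathbb T}I_b^\alpha h(t)=\int_t^b\frac{(s-\sigma(t))^{\alpha-1}}{\Gamma(\alpha)}h(s)\Delta s,$$ $I^0$ is the identity, ${}_a^{\mathbb T}D_t^\alpha h=\left({}_a^{\mathbb T}I_t^{1-\alpha}h\right)^\Delta$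 and ${}_t^{\mathbb T}D_b^\alpha h=-\left({}_t^{\mathbb T}I_b^{1-\alpha}h\right)^\Delta$ (left and right Riemann–Liouville derivatives). $W_{\Delta,b^-}^{\alpha,p}$ is the set of all $u\in L_\Delta^p$ for which there exists $g\in L_\Delta^p$ (the weak right fractional derivative) such that $\int_a^b u\cdot{}_a^{\mathbb T}D_t^\alpha\varphi\,\Delta t=\int_a^b g\cdot\varphi\,\Delta t$ for all $\varphi\in C_{c,rd}^\infty$, where $C_{c,rd}^\infty$ denotes the $\mathbb R^N$-valued functions on $J$ that are infinitely often delta differentiable with rd-continuous derivatives and have compact support in $(a,b)\cap\mathbb T$. For $u\in W_{\Delta,b^-}^{\alpha,p}$, ${}_t^{\mathbb T}D_b^\alpha u$ exists $\Delta$-a.e., equals $g$, and lies in $L_\Delta^p$.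
   Formalization: The kernel is taken as 0 at non-positive arguments; where the right derivative of u does not exist in L^p, its term in the norm is 0; for α=1 the continuous representative is used, with u(b):=u(ρ(b)) if b is left-scattered; test functions' left derivatives must exist a.e. *)

theory Defs
  imports "HOL-Analysis.Analysis"
begin

section \<open>Time scale calculus\<close>

definition fwd_jump :: "real set \<Rightarrow> real \<Rightarrow> real" where
  "fwd_jump S t = (if {s\<in>S. t < s} = {} then Sup S else Inf {s\<in>S. t < s})"

definition bwd_jump :: "real set \<Rightarrow> real \<Rightarrow> real" where
  "bwd_jump S t = (if {s\<in>S. s < t} = {} then Inf S else Sup {s\<in>S. s < t})"

text \<open>The set usually written \<open>S\<^sup>\<kappa>\<close>: \<open>S\<close> without its maximum, if that is left-scattered.\<close>

definition kappa :: "real set \<Rightarrow> real set" where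
  "kappa S = {t\<in>S. \<not> ((\<forall>s\<in>S. s \<le> t) \<and> bwd_jump S t < t)}"

text \<open>\<open>D\<close> is the Hilger derivative at \<open>t\<close>, over the time scale \<open>S\<close>, of \<open>f\<close>. It is unique for
  \<open>t \<in> kappa S\<close>, except when \<open>S = {t}\<close>.\<close>

definition has_delta_deriv ::
  "real set \<Rightarrow> (real \<Rightarrow> 'v::real_normed_vector) \<Rightarrow> 'v \<Rightarrow> real \<Rightarrow> bool" where
  "has_delta_deriv S f D t \<longleftrightarrow> t \<in> S \<and>
     (\<forall>\<epsilon>>0. \<exists>\<delta>>0. \<forall>s\<in>S. \<bar>s - t\<bar> < \<delta> \<longrightarrow>
        norm (f (fwd_jump S t) - f s - (fwd_jump S t - s) *\<^sub>R D) \<le> \<epsilon> * \<bar>fwd_jump S t - s\<bar>)"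

text \<open>The same for a function that is defined only at the points satisfying \<open>P\<close>: it has to be
  defined near \<open>t\<close> and at the jump of \<open>t\<close>.\<close>

definition has_partial_delta_deriv ::
  "real set \<Rightarrow> (real \<Rightarrow> bool) \<Rightarrow> (real \<Rightarrow> 'v::real_normed_vector) \<Rightarrow> 'v \<Rightarrow> real \<Rightarrow> bool" where
  "has_partial_delta_deriv S P f D t \<longleftrightarrow>
     P t \<and> P (fwd_jump S t) \<and> (\<forall>\<^sub>F s in at t within S. P s) \<and> has_delta_deriv S f D t"

definition rd_continuous_on :: "real set \<Rightarrow> (real \<Rightarrow> 'v::real_normed_vector) \<Rightarrow> bool" where
  "rd_continuous_on S f \<longleftrightarrow> (\<forall>t\<in>S.
     (fwd_jump S t = t \<and> (\<exists>s\<in>S. t < s) \<longrightarrow> continuous (at t within S) f) \<and>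
     (bwd_jump S t = t \<and> (\<exists>s\<in>S. s < t) \<longrightarrow> (\<exists>L. (f \<longlongrightarrow> L) (at t within S \<inter> {..<t}))))"

definition tsJ :: "real set \<Rightarrow> real \<Rightarrow> real \<Rightarrow> real set" where
  "tsJ T a b = {a..b} \<inter> T"

definition tsJ0 :: "real set \<Rightarrow> real \<Rightarrow> real \<Rightarrow> real set" where
  "tsJ0 T a b = {a..<b} \<inter> T"

text \<open>The Lebesgue \<open>\<Delta>\<close>-measure on \<open>[a,b) \<inter> T\<close>: the completion of the extension of the premeasure
  \<open>[c,d) \<inter> T \<mapsto> d - c\<close>, for \<open>c \<le> d\<close> in \<open>[a,b] \<inter> T\<close>.\<close>

definition delta_measure :: "real set \<Rightarrow> real \<Rightarrow> real \<Rightarrow> real measure" where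
  "delta_measure T a b = completion (extend_measure (tsJ0 T a b)
     {(c, d). c \<in> tsJ T a b \<and> d \<in> tsJ T a b \<and> c \<le> d}
     (\<lambda>(c, d). {c..<d} \<inter> T) (\<lambda>(c, d). ennreal (d - c)))"

section \<open>Lebesgue spaces\<close>

text \<open>\<open>Lp_fun\<close> consists of functions, of which only the restriction to \<open>[a,b) \<inter> T\<close> matters. The
  elements of the function spaces proper are the classes \<open>ae_class T a b u\<close> of such functions.\<close>

definition Lp_fun :: "real set \<Rightarrow> real \<Rightarrow> real \<Rightarrow> real \<Rightarrow> (real \<Rightarrow> real ^ 'n) set" where
  "Lp_fun T a b p = {u. u \<in> borel_measurable (delta_measure T a b) \<and>
     integrable (delta_measure T a b) (\<lambda>t. norm (u t) powr p)}"

definition Lp_norm :: "real set \<Rightarrow> real \<Rightarrow> real \<Rightarrow> real \<Rightarrow> (real \<Rightarrow> real ^ 'n) \<Rightarrow> real" where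
  "Lp_norm T a b p u = (LINT t|delta_measure T a b. norm (u t) powr p) powr (1 / p)"

definition ae_class ::
  "real set \<Rightarrow> real \<Rightarrow> real \<Rightarrow> (real \<Rightarrow> real ^ 'n) \<Rightarrow> (real \<Rightarrow> real ^ 'n) set" where
  "ae_class T a b u =
     {v \<in> borel_measurable (delta_measure T a b). AE t in delta_measure T a b. v t = u t}"

definition class_diff ::
  "(real \<Rightarrow> real ^ 'n) set \<Rightarrow> (real \<Rightarrow> real ^ 'n) set \<Rightarrow> (real \<Rightarrow> real ^ 'n) set" where
  "class_diff X Y = {\<lambda>t. u t - v t |u v. u \<in> X \<and> v \<in> Y}"

section \<open>Fractional integrals and derivatives\<close>

text \<open>\<open>x\<^bsup>\<beta>-1\<^esup> / \<Gamma>(\<beta>)\<close> for \<open>0 < \<beta> \<le> 1\<close>. For \<open>\<beta> < 1\<close> the power is undefined at the nonpositive numbers,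
  which do occur as values of \<open>t - \<sigma>(s)\<close> and \<open>s - \<sigma>(t)\<close> next to scattered points; such \<open>s\<close> contribute
  nothing. The case \<open>\<beta> = 1\<close> is separate because of \<open>0 powr 0 = 0\<close>.\<close>

definition RL_kernel :: "real \<Rightarrow> real \<Rightarrow> real" where
  "RL_kernel \<beta> x = (if \<beta> = 1 then 1 else if x > 0 then x powr (\<beta> - 1) / Gamma \<beta> else 0)"

definition left_int :: "real set \<Rightarrow> real \<Rightarrow> real \<Rightarrow> real \<Rightarrow> (real \<Rightarrow> real ^ 'n) \<Rightarrow> real \<Rightarrow> real ^ 'n" where
  "left_int T a b \<beta> h t = (if \<beta> = 0 then h t else
     (LINT s:{a..<t} \<inter> T|delta_measure T a b. RL_kernel \<beta> (t - fwd_jump T s) *\<^sub>R h s))"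

definition right_int :: "real set \<Rightarrow> real \<Rightarrow> real \<Rightarrow> real \<Rightarrow> (real \<Rightarrow> real ^ 'n) \<Rightarrow> real \<Rightarrow> real ^ 'n" where
  "right_int T a b \<beta> h t = (if \<beta> = 0 then h t else
     (LINT s:{t..<b} \<inter> T|delta_measure T a b. RL_kernel \<beta> (s - fwd_jump T t) *\<^sub>R h s))"

definition left_int_exists ::
  "real set \<Rightarrow> real \<Rightarrow> real \<Rightarrow> real \<Rightarrow> (real \<Rightarrow> real ^ 'n) \<Rightarrow> real \<Rightarrow> bool" where
  "left_int_exists T a b \<beta> h t \<longleftrightarrow> \<beta> = 0 \<or>
     set_integrable (delta_measure T a b) ({a..<t} \<inter> T)
       (\<lambda>s. RL_kernel \<beta> (t - fwd_jump T s) *\<^sub>R h s)"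

definition right_int_exists ::
  "real set \<Rightarrow> real \<Rightarrow> real \<Rightarrow> real \<Rightarrow> (real \<Rightarrow> real ^ 'n) \<Rightarrow> real \<Rightarrow> bool" where
  "right_int_exists T a b \<beta> h t \<longleftrightarrow> \<beta> = 0 \<or>
     set_integrable (delta_measure T a b) ({t..<b} \<inter> T)
       (\<lambda>s. RL_kernel \<beta> (s - fwd_jump T t) *\<^sub>R h s)"

text \<open>\<open>g\<close> is \<open>\<Delta>\<close>-a.e. the left Riemann--Liouville derivative of \<open>h\<close>. The time scale of the
  differentiation is \<open>[a,b] \<inter> T\<close>, the domain of \<open>h\<close>; on \<open>[a,b) \<inter> T\<close> its forward jump operator is
  that of \<open>T\<close>.\<close>

definition has_left_RL_deriv ::
  "real set \<Rightarrow> real \<Rightarrow> real \<Rightarrow> real \<Rightarrow> (real \<Rightarrow> real ^ 'n) \<Rightarrow> (real \<Rightarrow> real ^ 'n) \<Rightarrow> bool" where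
  "has_left_RL_deriv T a b \<alpha> h g \<longleftrightarrow> (AE t in delta_measure T a b.
     has_partial_delta_deriv (tsJ T a b)
       (left_int_exists T a b (1 - \<alpha>) h) (left_int T a b (1 - \<alpha>) h) (g t) t)"

text \<open>The same on the right, for the a.e. class of \<open>u\<close>. If \<open>\<alpha> < 1\<close> the choice of the representative \<open>v\<close>
  is immaterial, but for \<open>\<alpha> = 1\<close> the function to be differentiated is \<open>v\<close> itself. It is then the
  continuous representative. The class determines its values on \<open>[a,b) \<inter> T\<close>, and also at \<open>b\<close> if \<open>b\<close>
  is left-dense (where the equation for \<open>v b\<close> is trivial); otherwise \<open>v\<close> is extended to \<open>b\<close> by the
  value at the preceding point.\<close>

definition has_right_RL_deriv ::
  "real set \<Rightarrow> real \<Rightarrow> real \<Rightarrow> real \<Rightarrow> (real \<Rightarrow> real ^ 'n) \<Rightarrow> (real \<Rightarrow> real ^ 'n) \<Rightarrow> bool" where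
  "has_right_RL_deriv T a b \<alpha> u g \<longleftrightarrow> (\<exists>v.
     (AE t in delta_measure T a b. v t = u t) \<and>
     (\<alpha> = 1 \<longrightarrow> continuous_on (tsJ T a b) v \<and> v b = v (bwd_jump (tsJ T a b) b)) \<and>
     (AE t in delta_measure T a b.
        has_partial_delta_deriv (tsJ T a b)
          (right_int_exists T a b (1 - \<alpha>) v) (right_int T a b (1 - \<alpha>) v) (- g t) t))"

text \<open>The right derivative as an operator into \<open>L\<^sup>p\<close>, determined up to null sets, with the default
  value \<open>0\<close> at those \<open>u\<close> that have no derivative in \<open>L\<^sup>p\<close>.\<close>

definition right_RL_deriv ::
  "real set \<Rightarrow> real \<Rightarrow> real \<Rightarrow> real \<Rightarrow> real \<Rightarrow> (real \<Rightarrow> real ^ 'n) \<Rightarrow> real \<Rightarrow> real ^ 'n" where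
  "right_RL_deriv T a b \<alpha> p u =
     (if \<exists>g\<in>Lp_fun T a b p. has_right_RL_deriv T a b \<alpha> u g
      then SOME g. g \<in> Lp_fun T a b p \<and> has_right_RL_deriv T a b \<alpha> u g
      else (\<lambda>t. 0))"

section \<open>The right fractional Sobolev space\<close>

text \<open>\<open>\<psi> n\<close> is the \<open>n\<close>-th delta derivative of \<open>\<phi>\<close>; it is defined on the \<open>n\<close>-fold iterated
  \<open>kappa\<close> of \<open>[a,b] \<inter> T\<close>.\<close>

definition Cc_rd_infinity :: "real set \<Rightarrow> real \<Rightarrow> real \<Rightarrow> (real \<Rightarrow> real ^ 'n) set" where
  "Cc_rd_infinity T a b = {\<phi>.
     (\<exists>\<psi> :: nat \<Rightarrow> real \<Rightarrow> real ^ 'n. \<psi> 0 = \<phi> \<and>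
        (\<forall>n. rd_continuous_on ((kappa ^^ n) (tsJ T a b)) (\<psi> n) \<and>
             (\<forall>t\<in>(kappa ^^ Suc n) (tsJ T a b).
                has_delta_deriv ((kappa ^^ n) (tsJ T a b)) (\<psi> n) (\<psi> (Suc n) t) t))) \<and>
     compact (closure {t \<in> tsJ T a b. \<phi> t \<noteq> 0}) \<and>
     closure {t \<in> tsJ T a b. \<phi> t \<noteq> 0} \<subseteq> {a<..<b} \<inter> T}"

definition has_weak_right_deriv ::
  "real set \<Rightarrow> real \<Rightarrow> real \<Rightarrow> real \<Rightarrow> (real \<Rightarrow> real ^ 'n) \<Rightarrow> (real \<Rightarrow> real ^ 'n) \<Rightarrow> bool" where
  "has_weak_right_deriv T a b \<alpha> u g \<longleftrightarrow> (\<forall>\<phi>\<in>Cc_rd_infinity T a b.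
     \<exists>\<phi>'. has_left_RL_deriv T a b \<alpha> \<phi> \<phi>' \<and>
       integrable (delta_measure T a b) (\<lambda>t. u t \<bullet> \<phi>' t) \<and>
       integrable (delta_measure T a b) (\<lambda>t. g t \<bullet> \<phi> t) \<and>
       (LINT t|delta_measure T a b. u t \<bullet> \<phi>' t) = (LINT t|delta_measure T a b. g t \<bullet> \<phi> t))"

definition sobolev_right ::
  "real set \<Rightarrow> real \<Rightarrow> real \<Rightarrow> real \<Rightarrow> real \<Rightarrow> (real \<Rightarrow> real ^ 'n) set set" where
  "sobolev_right T a b \<alpha> p =
     ae_class T a b ` {u \<in> Lp_fun T a b p. \<exists>g\<in>Lp_fun T a b p. has_weak_right_deriv T a b \<alpha> u g}"

definition sobolev_right_norm ::
  "real set \<Rightarrow> real \<Rightarrow> real \<Rightarrow> real \<Rightarrow> real \<Rightarrow> (real \<Rightarrow> real ^ 'n) set \<Rightarrow> real" where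
  "sobolev_right_norm T a b \<alpha> p X =
     (let u = SOME u. u \<in> X in
      (Lp_norm T a b p u powr p + Lp_norm T a b p (right_RL_deriv T a b \<alpha> p u) powr p) powr (1 / p))"

definition sobolev_right_topology ::
  "real set \<Rightarrow> real \<Rightarrow> real \<Rightarrow> real \<Rightarrow> real \<Rightarrow> (real \<Rightarrow> real ^ 'n) set topology" where
  "sobolev_right_topology T a b \<alpha> p = topology (\<lambda>U. U \<subseteq> sobolev_right T a b \<alpha> p \<and>
     (\<forall>X\<in>U. \<exists>r>0. \<forall>Y\<in>sobolev_right T a b \<alpha> p.
        sobolev_right_norm T a b \<alpha> p (class_diff Y X) < r \<longrightarrow> Y \<in> U))"

lemma openin_sobolev_right_topology:
  "openin (sobolev_right_topology T a b \<alpha> p) U \<longleftrightarrow> U \<subseteq> sobolev_right T a b \<alpha> p \<and>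
     (\<forall>X\<in>U. \<exists>r>0. \<forall>Y\<in>sobolev_right T a b \<alpha> p.
        sobolev_right_norm T a b \<alpha> p (class_diff Y X) < r \<longrightarrow> Y \<in> U)"
proof -
  let ?W = "sobolev_right T a b \<alpha> p"
  let ?d = "\<lambda>X Y. sobolev_right_norm T a b \<alpha> p (class_diff Y X)"
  let ?O = "\<lambda>U. U \<subseteq> ?W \<and> (\<forall>X\<in>U. \<exists>r>0. \<forall>Y\<in>?W. ?d X Y < r \<longrightarrow> Y \<in> U)"
  have int: "?O (A \<inter> B)" if A: "?O A" and B: "?O B" for A B
  proof (intro conjI ballI)
    show "A \<inter> B \<subseteq> ?W" using A by blast
  next
    fix X assume X: "X \<in> A \<inter> B"
    obtain r where r: "r > 0" "\<forall>Y\<in>?W. ?d X Y < r \<longrightarrow> Y \<in> A" using A X by blast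
    obtain q where q: "q > 0" "\<forall>Y\<in>?W. ?d X Y < q \<longrightarrow> Y \<in> B" using B X by blast
    show "\<exists>r>0. \<forall>Y\<in>?W. ?d X Y < r \<longrightarrow> Y \<in> A \<inter> B"
      by (rule exI[of _ "min r q"]) (use r q in auto)
  qed
  have un: "?O (\<Union>K)" if K: "\<forall>A\<in>K. ?O A" for K
  proof (intro conjI ballI)
    show "\<Union>K \<subseteq> ?W" using K by blast
  next
    fix X assume "X \<in> \<Union>K"
    then obtain A where A: "A \<in> K" "X \<in> A" by blast
    then obtain r where "r > 0" "\<forall>Y\<in>?W. ?d X Y < r \<longrightarrow> Y \<in> A" using K by blast
    then show "\<exists>r>0. \<forall>Y\<in>?W. ?d X Y < r \<longrightarrow> Y \<in> \<Union>K" using A by blast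
  qed
  have "istopology ?O"
    unfolding istopology_def using int un by blast
  then have "openin (topology ?O) = ?O"
    by (rule topology_inverse')
  then show ?thesis
    unfolding sobolev_right_topology_def by (rule fun_cong)
qed

lemma topspace_sobolev_right_topology:
  "topspace (sobolev_right_topology T a b \<alpha> p) = sobolev_right T a b \<alpha> p"
proof (rule subset_antisym)
  show "topspace (sobolev_right_topology T a b \<alpha> p) \<subseteq> sobolev_right T a b \<alpha> p"
    using openin_sobolev_right_topology openin_topspace by blast
  show "sobolev_right T a b \<alpha> p \<subseteq> topspace (sobolev_right_topology T a b \<alpha> p)"
    by (rule openin_subset) (auto simp: openin_sobolev_right_topology intro: exI[of _ 1])
qed

end

theory Submission
  imports Defs
begin

text \<open>On the functions whose right Riemann--Liouville derivative lies in \<open>L\<^sup>p\<close>, the derivative is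
  linear and determined almost everywhere, so that \<open>u \<mapsto> (u, D u)\<close> identifies them, with the Sobolev
  norm, with a subset of \<open>L\<^sup>p \<times> L\<^sup>p\<close>; and \<open>L\<^sup>p\<close> of the delta measure is separable. The norm
  assigns the derivative \<open>0\<close> to the functions without an \<open>L\<^sup>p\<close> derivative. If the space contains
  such a function, then it contains a countable dense set because every \<open>L\<^sup>p\<close> approximation can
  be perturbed so as to make the difference one of them. Instead of the norm, we use its \<open>p\<close>-th
  power, which satisfies the triangle inequality up to the factor \<open>2\<^sup>p\<close>; this suffices for
  separability.\<close>

section \<open>Spaces of \<open>p\<close>-integrable functions\<close>

text \<open>Membership in the space is tested by the weak derivative, the norm contains the strong
  one, and the topology sees only norms of differences \<open>c - u\<close>. If every member has a
  strong derivative in L^p, the derivative of \<open>c - u\<close> is \<open>D c - D u\<close> a.e.,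
  and density in the product passes to the graph although the approximating pairs need not lie on
  it. Otherwise a function close to \<open>u\<close> in L^p may differ from it by one with a large
  derivative. The functions with a strong derivative form a linear subspace, so a small translation
  by a member outside it leaves this subspace and reaches the region where the derivative counts as
  \<open>0\<close>. The delicate point is that the a.e. class determines the derivative. For
  \<alpha> < 1 the fractional integral ignores null sets. For \<alpha> = 1 it is the function
  itself; there every right neighbourhood of a point of \<open>J0\<close> has positive measure,
  which makes the continuous representative unique. The factor \<open>2 powr p\<close> stems from
  norm (x + y) <= 2 max (norm x) (norm y); approximations in two steps therefore start from errors
  below e / (2 * 2 powr p).\<close>

definition Lp_space :: "real \<Rightarrow> 'a measure \<Rightarrow> ('a \<Rightarrow> 'v::{banach,second_countable_topology}) set" where
  "Lp_space p M = {f \<in> borel_measurable M. integrable M (\<lambda>x. norm (f x) powr p)}"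

definition Lp_modular :: "real \<Rightarrow> 'a measure \<Rightarrow> ('a \<Rightarrow> 'v::{banach,second_countable_topology}) \<Rightarrow> real" where
  "Lp_modular p M f = (LINT x|M. norm (f x) powr p)"

lemma Lp_modular_nonneg: "0 \<le> Lp_modular p M f"
  unfolding Lp_modular_def by (rule integral_nonneg_AE) simp

lemma norm_add_powr_le:
  fixes x y :: "'v::real_normed_vector"
  assumes "0 \<le> p"
  shows "norm (x + y) powr p \<le> 2 powr p * (norm x powr p + norm y powr p)"
proof -
  have "norm (x + y) powr p \<le> (2 * max (norm x) (norm y)) powr p"
    using norm_triangle_ineq[of x y] assms by (intro powr_mono2) auto
  also have "\<dots> = 2 powr p * max (norm x) (norm y) powr p"
    by (simp add: powr_mult)
  also have "\<dots> \<le> 2 powr p * (norm x powr p + norm y powr p)"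
    by (intro mult_left_mono) (auto simp: max_def)
  finally show ?thesis .
qed

lemma Lp_space_scaleR:
  assumes "f \<in> Lp_space p M"
  shows "(\<lambda>x. c *\<^sub>R f x) \<in> Lp_space p M"
  using assms by (auto simp: Lp_space_def powr_mult)

lemma Lp_modular_scaleR: "Lp_modular p M (\<lambda>x. c *\<^sub>R f x) = \<bar>c\<bar> powr p * Lp_modular p M f"
  by (simp add: Lp_modular_def powr_mult)

lemma Lp_modular_minus_commute: "Lp_modular p M (\<lambda>x. f x - g x) = Lp_modular p M (\<lambda>x. g x - f x)"
  by (simp add: Lp_modular_def norm_minus_commute)

lemma Lp_space_add:
  assumes f: "f \<in> Lp_space p M" and g: "g \<in> Lp_space p M" and p: "0 \<le> p"
  shows "(\<lambda>x. f x + g x) \<in> Lp_space p M"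
    and "Lp_modular p M (\<lambda>x. f x + g x) \<le> 2 powr p * (Lp_modular p M f + Lp_modular p M g)"
proof -
  have [measurable]: "f \<in> borel_measurable M" "g \<in> borel_measurable M"
    and i: "integrable M (\<lambda>x. norm (f x) powr p)" "integrable M (\<lambda>x. norm (g x) powr p)"
    using f g by (auto simp: Lp_space_def)
  have j: "integrable M (\<lambda>x. 2 powr p * (norm (f x) powr p + norm (g x) powr p))"
    using i by auto
  have k: "integrable M (\<lambda>x. norm (f x + g x) powr p)"
    by (rule Bochner_Integration.integrable_bound[OF j])
      (use norm_add_powr_le[OF p] in \<open>auto simp del: distrib_left_numeral intro!: AE_I2\<close>)
  then show "(\<lambda>x. f x + g x) \<in> Lp_space p M" by (simp add: Lp_space_def)
  have "Lp_modular p M (\<lambda>x. f x + g x) \<le> (LINT x|M. 2 powr p * (norm (f x) powr p + norm (g x) powr p))"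
    unfolding Lp_modular_def by (rule integral_mono[OF k j]) (rule norm_add_powr_le[OF p])
  also have "\<dots> = 2 powr p * (Lp_modular p M f + Lp_modular p M g)"
    using i by (simp add: Lp_modular_def)
  finally show "Lp_modular p M (\<lambda>x. f x + g x) \<le> 2 powr p * (Lp_modular p M f + Lp_modular p M g)" .
qed

lemma Lp_space_diff:
  assumes "f \<in> Lp_space p M" and "g \<in> Lp_space p M" and "0 \<le> p"
  shows "(\<lambda>x. f x - g x) \<in> Lp_space p M"
  using Lp_space_add(1)[OF assms(1) Lp_space_scaleR[OF assms(2), of "-1"] assms(3)] by simp

lemma Lp_modular_triangle:
  assumes "f \<in> Lp_space p M" and "g \<in> Lp_space p M" and "h \<in> Lp_space p M" and "0 \<le> p"
  shows "Lp_modular p M (\<lambda>x. f x - h x)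
    \<le> 2 powr p * (Lp_modular p M (\<lambda>x. f x - g x) + Lp_modular p M (\<lambda>x. g x - h x))"
  using Lp_space_add(2)[OF Lp_space_diff[OF assms(1,2,4)] Lp_space_diff[OF assms(2,3,4)] assms(4)]
  by simp

lemma Lp_modular_cong_AE:
  assumes "f \<in> borel_measurable M" and "g \<in> borel_measurable M" and "AE x in M. f x = g x"
  shows "Lp_modular p M f = Lp_modular p M g"
  unfolding Lp_modular_def using assms by (intro integral_cong_AE) auto

lemma Lp_modular_dominated_convergence:
  assumes f: "f \<in> borel_measurable M" and s: "\<And>i. s i \<in> borel_measurable M"
    and w: "integrable M w" and lim: "AE x in M. (\<lambda>i. s i x) \<longlonglongrightarrow> f x"
    and bound: "\<And>i. AE x in M. norm (f x - s i x) powr p \<le> w x" and p: "0 < p"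
  shows "(\<lambda>i. Lp_modular p M (\<lambda>x. f x - s i x)) \<longlonglongrightarrow> 0"
proof -
  have "(\<lambda>i. LINT x|M. norm (f x - s i x) powr p) \<longlonglongrightarrow> (LINT x|M. 0)"
  proof (rule integral_dominated_convergence[OF _ _ w])
    show "AE x in M. (\<lambda>i. norm (f x - s i x) powr p) \<longlonglongrightarrow> 0"
      using lim
    proof eventually_elim
      case (elim x)
      have "(\<lambda>i. norm (f x - s i x)) \<longlonglongrightarrow> 0"
        using tendsto_diff[OF tendsto_const elim, of "f x"] by (simp add: tendsto_norm_zero)
      then show ?case
        using tendsto_powr'[of "\<lambda>i. norm (f x - s i x)" 0 sequentially "\<lambda>_. p" p] p by simp
    qed
  qed (use f s bound in auto)
  then show ?thesis by (simp add: Lp_modular_def)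
qed

section \<open>Closure of a set of functions in L^p\<close>

definition Lp_closure :: "real \<Rightarrow> 'a measure \<Rightarrow> ('a \<Rightarrow> 'v::{banach,second_countable_topology}) set \<Rightarrow> ('a \<Rightarrow> 'v) set" where
  "Lp_closure p M S = {f \<in> Lp_space p M. \<forall>e>0. \<exists>s\<in>S. Lp_modular p M (\<lambda>x. f x - s x) < e}"

text \<open>Idempotence of the closure: density can be reduced step by step to simpler functions
  already known to lie in it.\<close>

lemma Lp_closure_approx:
  assumes f: "f \<in> Lp_space p M" and S: "S \<subseteq> Lp_space p M" and p: "0 \<le> p"
    and ap: "\<And>e. 0 < e \<Longrightarrow> \<exists>g\<in>Lp_closure p M S. Lp_modular p M (\<lambda>x. f x - g x) < e"
  shows "f \<in> Lp_closure p M S"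
  unfolding Lp_closure_def
proof (intro CollectI conjI f allI impI)
  fix e :: real assume "0 < e"
  define d where "d = e / (2 * 2 powr p)"
  have d: "0 < d" using \<open>0 < e\<close> by (simp add: d_def)
  obtain g where g: "g \<in> Lp_closure p M S" "Lp_modular p M (\<lambda>x. f x - g x) < d"
    using ap[OF d] by blast
  then obtain s where s: "s \<in> S" "Lp_modular p M (\<lambda>x. g x - s x) < d"
    using d by (auto simp: Lp_closure_def)
  have "Lp_modular p M (\<lambda>x. f x - s x)
      \<le> 2 powr p * (Lp_modular p M (\<lambda>x. f x - g x) + Lp_modular p M (\<lambda>x. g x - s x))"
    using f g s S p by (intro Lp_modular_triangle) (auto simp: Lp_closure_def)
  also have "\<dots> < 2 powr p * (d + d)"
    using g s by (intro mult_strict_left_mono add_strict_mono) auto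
  also have "\<dots> = e" by (simp add: d_def)
  finally show "\<exists>s\<in>S. Lp_modular p M (\<lambda>x. f x - s x) < e" using s by blast
qed

lemma Lp_closure_lim:
  assumes "f \<in> Lp_space p M" and "S \<subseteq> Lp_space p M" and "0 \<le> p"
    and g: "\<And>i::nat. g i \<in> Lp_closure p M S"
    and lim: "(\<lambda>i. Lp_modular p M (\<lambda>x. f x - g i x)) \<longlonglongrightarrow> 0"
  shows "f \<in> Lp_closure p M S"
proof (rule Lp_closure_approx[OF assms(1-3)])
  fix e :: real assume "0 < e"
  then have "\<forall>\<^sub>F i in sequentially. Lp_modular p M (\<lambda>x. f x - g i x) < e"
    using lim by (simp add: order_tendstoD(2))
  then show "\<exists>g\<in>Lp_closure p M S. Lp_modular p M (\<lambda>x. f x - g x) < e"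
    using g eventually_happens[of _ sequentially] by fastforce
qed

text \<open>\<open>S\<close> has to be additive only: the dense set below consists of sums with
  coefficients from a countable set and need not be a vector space.\<close>

lemma Lp_closure_add:
  assumes f: "f \<in> Lp_closure p M S" and g: "g \<in> Lp_closure p M S"
    and S: "S \<subseteq> Lp_space p M" and p: "0 \<le> p"
    and add: "\<And>s t. s \<in> S \<Longrightarrow> t \<in> S \<Longrightarrow> (\<lambda>x. s x + t x) \<in> S"
  shows "(\<lambda>x. f x + g x) \<in> Lp_closure p M S"
  unfolding Lp_closure_def
proof (intro CollectI conjI allI impI)
  show "(\<lambda>x. f x + g x) \<in> Lp_space p M"
    using f g p by (auto simp: Lp_closure_def intro: Lp_space_add)
  fix e :: real assume "0 < e"
  define d where "d = e / (2 * 2 powr p)"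
  have d: "0 < d" using \<open>0 < e\<close> by (simp add: d_def)
  obtain s t where s: "s \<in> S" "Lp_modular p M (\<lambda>x. f x - s x) < d"
    and t: "t \<in> S" "Lp_modular p M (\<lambda>x. g x - t x) < d"
    using f g d unfolding Lp_closure_def by blast
  have "Lp_modular p M (\<lambda>x. (f x + g x) - (s x + t x))
      = Lp_modular p M (\<lambda>x. (f x - s x) + (g x - t x))" by (simp add: algebra_simps)
  also have "\<dots> \<le> 2 powr p * (Lp_modular p M (\<lambda>x. f x - s x) + Lp_modular p M (\<lambda>x. g x - t x))"
    using f g s t S p by (intro Lp_space_add(2) Lp_space_diff) (auto simp: Lp_closure_def)
  also have "\<dots> < 2 powr p * (d + d)"
    using s t by (intro mult_strict_left_mono add_strict_mono) auto
  also have "\<dots> = e" by (simp add: d_def)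
  finally show "\<exists>s\<in>S. Lp_modular p M (\<lambda>x. (f x + g x) - s x) < e"
    by (intro bexI[OF _ add[OF s(1) t(1)]]) simp
qed

section \<open>A countable dense subset of L^p for a finite measure on the line\<close>

lemma borel_eq_lessThan_rat: "(borel :: real measure) = sigma UNIV (range (\<lambda>q::rat. {..<real_of_rat q}))"
proof (rule borel_eq_sigmaI1[where X = "range lessThan"])
  show "borel = sigma UNIV (range (lessThan :: real \<Rightarrow> _))"
    using borel_eq_lessThan[where 'a = real] by (simp add: eucl_lessThan)
next
  fix X :: "real set" assume "X \<in> range lessThan"
  then obtain x where X: "X = {..<x}" by blast
  have "{..<x} = (\<Union>q\<in>{q::rat. real_of_rat q \<le> x}. {..<real_of_rat q})"
  proof (intro equalityI subsetI)
    fix y assume "y \<in> {..<x}"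
    then obtain q where "y < real_of_rat q" "real_of_rat q < x"
      using of_rat_dense[of y x] by auto
    then show "y \<in> (\<Union>q\<in>{q::rat. real_of_rat q \<le> x}. {..<real_of_rat q})" by force
  qed auto
  also have "\<dots> \<in> sets (sigma UNIV (range (\<lambda>q::rat. {..<real_of_rat q})))"
    by (rule sets.countable_UN'') auto
  finally show "X \<in> sets (sigma UNIV (range (\<lambda>q::rat. {..<real_of_rat q})))" by (simp add: X)
qed auto

lemma Lp_space_indicator:
  assumes "finite_measure M" and "A \<in> sets M"
  shows "(\<lambda>x. indicator A x *\<^sub>R y) \<in> Lp_space p M"
proof -
  interpret finite_measure M by fact
  have "(\<lambda>x. norm (indicator A x *\<^sub>R y) powr p) = (\<lambda>x. indicator A x * norm y powr p)"
    by (auto simp: indicator_def)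
  then show ?thesis
    using assms by (auto simp: Lp_space_def emeasure_eq_measure)
qed

text \<open>The dense set consists of finite sums of indicators of rational rays with coefficients
  in a countable dense set of values. The sets whose indicators, with every coefficient, lie in the
  closure form a Dynkin system, so they include the Borel sets; simple functions then give all of
  L^p. Sets of \<open>M\<close> are Borel only up to null sets because the measure in view is a
  completion.\<close>

lemma Lp_countable_dense:
  fixes M :: "real measure"
  assumes fin: "finite_measure M" and id: "(\<lambda>x. x) \<in> borel_measurable M"
    and borel: "\<And>A. A \<in> sets M \<Longrightarrow> \<exists>B\<in>sets borel. AE x in M. x \<in> A \<longleftrightarrow> x \<in> B"
    and p: "0 < p"
  shows "\<exists>S :: (real \<Rightarrow> 'v::{banach,second_countable_topology}) set.
    countable S \<and> S \<subseteq> Lp_space p M \<and> Lp_closure p M S = Lp_space p M"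
proof -
  interpret finite_measure M by fact
  have p': "0 \<le> p" using p by simp
  have meas: "space M \<inter> B \<in> sets M" if "B \<in> sets borel" for B
    using measurable_sets[OF id that] by (simp add: Int_commute)
  obtain Q :: "'v set" where Q: "countable Q" "\<And>X. open X \<Longrightarrow> X \<noteq> {} \<Longrightarrow> \<exists>d\<in>Q. d \<in> X"
    by (erule countable_dense_setE)
  \<comment> \<open>\<open>UNIV\<close> is adjoined for the complements, whose indicators are
    differences from that of \<open>UNIV\<close>.\<close>
  define G :: "real set set" where "G = insert UNIV (range (\<lambda>q::rat. {..<real_of_rat q}))"
  \<comment> \<open>Lists make the sums closed under addition, by concatenation, and countable in
    number. The intersection with \<open>space M\<close> is there because the space may be a proper
    subset of the line.\<close>
  define F :: "(real set \<times> 'v) list \<Rightarrow> real \<Rightarrow> 'v" where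
    "F l x = (\<Sum>(B, y)\<leftarrow>l. indicator (space M \<inter> B) x *\<^sub>R y)" for l x
  define S where "S = F ` lists (G \<times> Q)"
  have Gb: "B \<in> sets borel" if "B \<in> G" for B
    using that by (auto simp: G_def)
  have "countable S"
    using Q by (auto simp: S_def G_def intro!: countable_image countable_lists)
  have SL: "S \<subseteq> Lp_space p M"
  proof
    fix s assume "s \<in> S"
    then obtain l where l: "l \<in> lists (G \<times> Q)" and s: "s = F l" by (auto simp: S_def)
    have "F l \<in> Lp_space p M" using l
    proof (induction l)
      case Nil
      have "(\<lambda>x. 0) \<in> Lp_space p M" by (simp add: Lp_space_def)
      then show ?case unfolding F_def by simp
    next
      case (Cons z l)
      obtain B y where z: "z = (B, y)" "B \<in> G" using Cons.hyps by auto
      have "(\<lambda>x. indicator (space M \<inter> B) x *\<^sub>R y + F l x) \<in> Lp_space p M"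
        using z Cons.IH by (intro Lp_space_add Lp_space_indicator fin meas Gb p') auto
      then show ?case by (simp add: F_def z)
    qed
    then show "s \<in> Lp_space p M" by (simp add: s)
  qed
  have S_add: "(\<lambda>x. s x + t x) \<in> S" if st: "s \<in> S" "t \<in> S" for s t
  proof -
    obtain k l where "k \<in> lists (G \<times> Q)" "s = F k" "l \<in> lists (G \<times> Q)" "t = F l"
      using st by (auto simp: S_def)
    then show ?thesis unfolding S_def
      by (intro image_eqI[of _ _ "k @ l"]) (auto simp: F_def)
  qed
  let ?C = "Lp_closure p M S"
  have C_add: "(\<lambda>x. f x + g x) \<in> ?C" if "f \<in> ?C" "g \<in> ?C" for f g
    using Lp_closure_add[OF that SL p' S_add] by blast
  have zero: "(\<lambda>x. 0) \<in> ?C"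
  proof -
    have "F [] \<in> S" by (auto simp: S_def)
    then show ?thesis
      using p by (auto simp: Lp_closure_def F_def Lp_space_def Lp_modular_def intro!: bexI[of _ "F []"])
  qed
  have C_sum: "(\<lambda>x. \<Sum>i\<in>I. f i x) \<in> ?C" if "finite I" "\<And>i. i \<in> I \<Longrightarrow> f i \<in> ?C"
    for I and f :: "'i \<Rightarrow> real \<Rightarrow> 'v"
    using that by (induction I rule: finite_induct) (auto intro: zero C_add)
  have G_ind: "(\<lambda>x. indicator (space M \<inter> B) x *\<^sub>R y) \<in> ?C" if B: "B \<in> G" for B y
  proof (rule Lp_closure_approx[OF Lp_space_indicator[OF fin meas[OF Gb[OF B]]] SL p'])
    fix e :: real assume e: "0 < e"
    define m where "m = measure M (space M \<inter> B)"
    \<comment> \<open>Chosen so that \<open>m * d powr p < e\<close>; the summand 1 covers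
      \<open>m = 0\<close>.\<close>
    define d where "d = (e / (m + 1)) powr (1 / p)"
    have m: "0 \<le> m" by (simp add: m_def)
    have "0 < d" using e m by (simp add: d_def)
    then obtain q where q: "q \<in> Q" "norm (y - q) < d"
      using Q(2)[of "ball y d"] by (auto simp: dist_norm)
    define f :: "real \<Rightarrow> 'v" where "f x = indicator (space M \<inter> B) x *\<^sub>R q" for x
    have f: "f \<in> S"
      unfolding S_def using B q
      by (intro image_eqI[of _ _ "[(B, q)]"]) (auto simp: F_def f_def fun_eq_iff)
    have "f \<in> ?C"
      using f SL by (auto simp: Lp_closure_def Lp_modular_def p intro!: bexI[of _ f])
    moreover have "Lp_modular p M (\<lambda>x. indicator (space M \<inter> B) x *\<^sub>R y - f x) < e"
    proof -
      have "(\<lambda>x. norm (indicator (space M \<inter> B) x *\<^sub>R y - f x) powr p)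
          = (\<lambda>x. indicator (space M \<inter> B) x * norm (y - q) powr p)"
        by (auto simp: f_def indicator_def fun_eq_iff)
      then have "Lp_modular p M (\<lambda>x. indicator (space M \<inter> B) x *\<^sub>R y - f x) = m * norm (y - q) powr p"
        using sets.sets_into_space[OF meas[OF Gb[OF B]]] by (simp add: Lp_modular_def m_def Int_absorb2)
      also have "\<dots> \<le> m * d powr p"
        using q p m by (intro mult_left_mono powr_mono2) auto
      also have "\<dots> = m * (e / (m + 1))"
        using p e m by (simp add: d_def powr_powr)
      also have "\<dots> < e" using e m by (simp add: field_simps)
      finally show ?thesis .
    qed
    ultimately show "\<exists>g\<in>?C. Lp_modular p M (\<lambda>x. indicator (space M \<inter> B) x *\<^sub>R y - g x) < e"
      by blast
  qed
  \<comment> \<open>The quantifier over \<open>y\<close> belongs to the induction: a complement uses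
    its hypothesis with \<open>- y\<close>.\<close>
  have borel_ind: "\<forall>y. (\<lambda>x. indicator (space M \<inter> B) x *\<^sub>R y) \<in> ?C" if "B \<in> sets borel" for B
  proof -
    have sig: "B \<in> sigma_sets UNIV (range (\<lambda>q::rat. {..<real_of_rat q}))" if "B \<in> sets borel" for B
      using that by (simp add: borel_eq_lessThan_rat)
    have gis: "B \<in> sets borel" if "B \<in> sigma_sets UNIV (range (\<lambda>q::rat. {..<real_of_rat q}))" for B :: "real set"
      using that by (simp add: borel_eq_lessThan_rat)
    have "Int_stable (range (\<lambda>q::rat. {..<real_of_rat q}))"
    proof (rule Int_stableI)
      fix A B :: "real set"
      assume "A \<in> range (\<lambda>q. {..<real_of_rat q})" "B \<in> range (\<lambda>q. {..<real_of_rat q})"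
      then obtain q r where "A = {..<real_of_rat q}" "B = {..<real_of_rat r}" by auto
      then have "A \<inter> B = {..<real_of_rat (min q r)}"
        using of_rat_less_eq[of q r, where 'a = real] by (auto simp: min_def)
      then show "A \<inter> B \<in> range (\<lambda>q. {..<real_of_rat q})" by blast
    qed
    moreover have "range (\<lambda>q::rat. {..<real_of_rat q}) \<subseteq> Pow UNIV" by simp
    ultimately show ?thesis using sig[OF that]
    proof (induction rule: sigma_sets_induct_disjoint)
      case (basic A)
      then show ?case using G_ind[of A] by (auto simp: G_def)
    next
      case empty
      then show ?case using zero by simp
    next
      case (compl A)
      show ?case
      proof
        fix y
        have "(\<lambda>x. indicator (space M \<inter> UNIV) x *\<^sub>R y + indicator (space M \<inter> A) x *\<^sub>R (- y)) \<in> ?C"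
          using spec[OF compl(2), of "- y"] G_ind[of UNIV y] by (intro C_add) (simp_all add: G_def)
        also have "(\<lambda>x. indicator (space M \<inter> UNIV) x *\<^sub>R y + indicator (space M \<inter> A) x *\<^sub>R (- y))
          = (\<lambda>x. indicator (space M \<inter> (UNIV - A)) x *\<^sub>R y)"
          by (auto simp: indicator_def fun_eq_iff)
        finally show "(\<lambda>x. indicator (space M \<inter> (UNIV - A)) x *\<^sub>R y) \<in> ?C" .
      qed
    next
      case (union A)
      have Ab: "A i \<in> sets borel" for i using union gis by blast
      show ?case
      proof
        fix y :: 'v
        define f where "f x = indicator (space M \<inter> (\<Union>i. A i)) x *\<^sub>R y" for x
        define s where "s n x = (\<Sum>i<n. indicator (space M \<inter> A i) x *\<^sub>R y)" for n :: nat and x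
        \<comment> \<open>Disjointness identifies the partial sums, which lie in the closure by
          additivity, with indicators of partial unions; the errors are then bounded by
          \<open>norm y\<close>.\<close>
        have s_eq: "s n x = indicator (space M \<inter> (\<Union>i<n. A i)) x *\<^sub>R y" for n x
        proof -
          have "(\<Union>i<n. space M \<inter> A i) = space M \<inter> (\<Union>i<n. A i)" by auto
          moreover have "disjoint_family_on (\<lambda>i. space M \<inter> A i) {..<n}"
            using union(1) by (auto simp: disjoint_family_on_def)
          ultimately have "(indicator (space M \<inter> (\<Union>i<n. A i)) x :: real) = (\<Sum>i<n. indicator (space M \<inter> A i) x)"
            using indicator_UN_disjoint[of "{..<n}" "\<lambda>i. space M \<inter> A i" x] by simp
          then show ?thesis by (simp add: s_def scaleR_sum_left)
        qed
        have f: "f \<in> Lp_space p M" unfolding f_def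
          by (intro Lp_space_indicator[OF fin] meas) (use Ab in auto)
        have sC: "s n \<in> ?C" for n unfolding s_def using union by (intro C_sum) auto
        have "(\<lambda>n. Lp_modular p M (\<lambda>x. f x - s n x)) \<longlonglongrightarrow> 0"
        proof (rule Lp_modular_dominated_convergence[OF _ _ _ _ _ p, where w = "\<lambda>x. norm y powr p"])
          show "f \<in> borel_measurable M" using f by (simp add: Lp_space_def)
          show "s n \<in> borel_measurable M" for n using sC by (auto simp: Lp_closure_def Lp_space_def)
          show "AE x in M. (\<lambda>n. s n x) \<longlonglongrightarrow> f x"
          proof (rule AE_I2)
            fix x assume x: "x \<in> space M"
            show "(\<lambda>n. s n x) \<longlonglongrightarrow> f x"
            proof (cases "x \<in> (\<Union>i. A i)")
              case True
              then obtain i where "x \<in> A i" by blast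
              then have "s n x = f x" if "i < n" for n
                using that x unfolding s_eq f_def by (subst (1 2) indicator_simps(1)) auto
              then show ?thesis
                by (intro tendsto_eventually eventually_sequentiallyI[of "Suc i"]) auto
            qed (simp add: s_eq f_def)
          qed
          show "AE x in M. norm (f x - s n x) powr p \<le> norm y powr p" for n
            by (intro AE_I2) (auto simp: s_eq f_def indicator_def)
        qed auto
        then have "f \<in> ?C" by (rule Lp_closure_lim[OF f SL p' sC])
        then show "(\<lambda>x. indicator (space M \<inter> (\<Union>i. A i)) x *\<^sub>R y) \<in> ?C" by (simp add: f_def[abs_def])
      qed
    qed
  qed
  \<comment> \<open>From Borel sets to sets of \<open>M\<close>: the two indicators agree a.e., so
    the modular of their difference is 0.\<close>
  have ind: "(\<lambda>x. indicat_real A x *\<^sub>R y) \<in> ?C" if A: "A \<in> sets M" for A y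
  proof -
    obtain B where B: "B \<in> sets borel" "AE x in M. x \<in> A \<longleftrightarrow> x \<in> B" using borel[OF A] by blast
    let ?f = "\<lambda>x. indicator A x *\<^sub>R y" and ?g = "\<lambda>x. indicator (space M \<inter> B) x *\<^sub>R y"
    have [measurable]: "A \<in> sets M" "space M \<inter> B \<in> sets M" using A meas B by auto
    have "AE x in M. ?f x - ?g x = 0"
      using B(2) AE_space by eventually_elim (auto simp: indicator_def)
    then have "Lp_modular p M (\<lambda>x. ?f x - ?g x) = Lp_modular p M (\<lambda>x. 0 :: 'v)"
      by (intro Lp_modular_cong_AE) auto
    then show ?thesis
      using borel_ind[OF B(1)] p
      by (intro Lp_closure_approx[OF Lp_space_indicator[OF fin A] SL p'] bexI[of _ ?g])
        (auto simp: Lp_modular_def)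
  qed
  have "f \<in> ?C" if f: "f \<in> Lp_space p M" for f
  proof -
    have fm: "f \<in> borel_measurable M" and fi: "integrable M (\<lambda>x. norm (f x) powr p)"
      using f by (auto simp: Lp_space_def)
    obtain s where s': "\<forall>i. simple_function M (s i)" "\<forall>x\<in>space M. (\<lambda>i. s i x) \<longlonglongrightarrow> f x"
      "\<forall>i. \<forall>x\<in>space M. dist (s i x) 0 \<le> 2 * dist (f x) 0"
      using borel_measurable_implies_sequence_metric[OF fm, of 0] by blast
    have s: "simple_function M (s i)" "x \<in> space M \<Longrightarrow> (\<lambda>i. s i x) \<longlonglongrightarrow> f x"
      "x \<in> space M \<Longrightarrow> norm (s i x) \<le> 2 * norm (f x)" for i x
      using s' by simp_all
    \<comment> \<open>On \<open>space M\<close> this is the simple function \<open>s i\<close>,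
      written as a finite sum of indicators so that \<open>C_sum\<close> applies.\<close>
    define t where "t i x = (\<Sum>y\<in>s i ` space M. indicator (s i -` {y} \<inter> space M) x *\<^sub>R y)" for i x
    have st: "t i x = s i x" if "x \<in> space M" for i x
      unfolding t_def by (rule simple_function_indicator_representation_banach[OF s(1) that, symmetric])
    have tC: "t i \<in> ?C" for i unfolding t_def
    proof (rule C_sum)
      show "finite (s i ` space M)" using s(1)[of i] by (rule simple_functionD(1))
    qed (rule ind[OF simple_functionD(2)[OF s(1)]])
    have "(\<lambda>i. Lp_modular p M (\<lambda>x. f x - t i x)) \<longlonglongrightarrow> 0"
    proof (rule Lp_modular_dominated_convergence[OF fm _ _ _ _ p])
      show "t i \<in> borel_measurable M" for i using tC by (auto simp: Lp_closure_def Lp_space_def)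
      show "integrable M (\<lambda>x. 3 powr p * norm (f x) powr p)" using fi by simp
      show "AE x in M. (\<lambda>i. t i x) \<longlonglongrightarrow> f x"
        using s(2) by (intro AE_I2) (simp add: st)
      show "AE x in M. norm (f x - t i x) powr p \<le> 3 powr p * norm (f x) powr p" for i
      proof (rule AE_I2)
        fix x assume x: "x \<in> space M"
        \<comment> \<open>3 = 1 + 2, from the bound \<open>2 * norm (f x)\<close> for the simple
          functions.\<close>
        have "norm (f x - t i x) \<le> 3 * norm (f x)"
          using norm_triangle_ineq4[of "f x" "s i x"] s(3)[OF x, of i] by (simp add: st[OF x])
        then have "norm (f x - t i x) powr p \<le> (3 * norm (f x)) powr p"
          using p by (intro powr_mono2) auto
        then show "norm (f x - t i x) powr p \<le> 3 powr p * norm (f x) powr p"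
          by (simp add: powr_mult)
      qed
    qed
    then show ?thesis by (rule Lp_closure_lim[OF f SL p' tC])
  qed
  then have "?C = Lp_space p M" by (auto simp: Lp_closure_def)
  with \<open>countable S\<close> SL show ?thesis by blast
qed

text \<open>The points of \<open>S\<close> need not lie in \<open>A\<close>, and \<open>d\<close>
  compares a point of \<open>A\<close> with one of \<open>S\<close>. For each \<open>s\<close> and
  each radius 1 / (n + 1) one point of \<open>A\<close> within that radius is selected, if there is
  any; two points of \<open>A\<close> near the same \<open>s\<close> are close to each other by
  \<open>tri\<close>.\<close>

lemma countable_dense_subset:
  fixes d :: "'a \<Rightarrow> 's \<Rightarrow> real"
  assumes S: "countable S" and dense: "\<And>x e. x \<in> A \<Longrightarrow> 0 < e \<Longrightarrow> \<exists>s\<in>S. d x s < e"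
    and tri: "\<And>x y s. x \<in> A \<Longrightarrow> y \<in> A \<Longrightarrow> s \<in> S \<Longrightarrow> d' x y \<le> K * (d x s + d y s)" and K: "0 < K"
  shows "\<exists>C\<subseteq>A. countable C \<and> (\<forall>x\<in>A. \<forall>e>0. \<exists>c\<in>C. d' c x < (e::real))"
proof -
  define near where "near s n x \<longleftrightarrow> x \<in> A \<and> d x s < inverse (Suc n)" for s n x
  define I where "I = {(s, n). s \<in> S \<and> (\<exists>x. near s n x)}"
  define C where "C = (\<lambda>(s, n). SOME x. near s n x) ` I"
  have some: "near s n (SOME x. near s n x)" if "near s n x" for s n x
    using someI[of "near s n", OF that] .
  have "countable C"
    unfolding C_def
    by (rule countable_image, rule countable_subset[of _ "S \<times> UNIV"]) (use S in \<open>auto simp: I_def\<close>)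
  moreover have "C \<subseteq> A"
    using some by (auto simp: C_def I_def near_def)
  moreover have "\<exists>c\<in>C. d' c x < e" if x: "x \<in> A" and e: "0 < e" for x and e :: real
  proof -
    obtain n where n: "inverse (Suc n) < e / (2 * K)"
      using reals_Archimedean[of "e / (2 * K)"] e K by auto
    obtain s where s: "s \<in> S" "d x s < inverse (Suc n)"
      using dense[OF x, of "inverse (Suc n)"] by auto
    define c where "c = (SOME x. near s n x)"
    have c: "near s n c"
      using some[of s n x] x s by (simp add: near_def c_def)
    have "c \<in> C"
      using s x unfolding C_def c_def I_def near_def
      by (intro image_eqI[of _ _ "(s, n)"]) auto
    moreover have "d' c x \<le> K * (d c s + d x s)"
      using c x s by (intro tri) (auto simp: near_def)
    moreover have "K * (d c s + d x s) < K * (2 * inverse (Suc n))"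
      using c s K by (intro mult_strict_left_mono) (auto simp: near_def)
    moreover have "K * (2 * inverse (Suc n)) < K * (2 * (e / (2 * K)))"
      using n K by (intro mult_strict_left_mono) auto
    moreover have "K * (2 * (e / (2 * K))) = e" using K by simp
    ultimately show ?thesis by (intro bexI[of _ c]) linarith+
  qed
  ultimately show ?thesis by blast
qed

section \<open>The delta measure\<close>

text \<open>Preimages under \<open>f\<close> and \<open>g\<close> differ by a subset of a null set,
  which is measurable by completeness. This is meant for products with a left derivative, which is
  known only a.e. and not assumed measurable.\<close>

lemma (in complete_measure) measurable_cong_AE:
  assumes f: "f \<in> measurable M N" and eq: "AE x in M. f x = g x"
    and g: "\<And>x. x \<in> space M \<Longrightarrow> g x \<in> space N"
  shows "g \<in> measurable M N"
proof (rule measurableI)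
  fix A assume A: "A \<in> sets N"
  show "g -` A \<inter> space M \<in> sets M"
  proof (rule in_sets_AE)
    show "AE x in M. x \<in> f -` A \<inter> space M \<longleftrightarrow> x \<in> g -` A \<inter> space M"
      using eq by eventually_elim auto
  qed (use f A in \<open>auto intro: measurable_sets\<close>)
qed (rule g)

locale time_scale_interval =
  fixes T :: "real set" and a b :: real
  assumes closed_T: "closed T" and a_in: "a \<in> T" and b_in: "b \<in> T" and a_less_b: "a < b"
begin

abbreviation "J \<equiv> tsJ T a b"
abbreviation "J0 \<equiv> tsJ0 T a b"
abbreviation "\<Delta> \<equiv> delta_measure T a b"

definition pre_measure :: "real measure" where
  "pre_measure = extend_measure J0 {(c, d). c \<in> J \<and> d \<in> J \<and> c \<le> d}
     (\<lambda>(c, d). {c..<d} \<inter> T) (\<lambda>(c, d). ennreal (d - c))"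

lemma delta_measure_eq: "\<Delta> = completion pre_measure"
  by (simp add: delta_measure_def pre_measure_def)

lemma intervals_subset:
  "(\<lambda>(c, d). {c..<d} \<inter> T) ` {(c, d). c \<in> J \<and> d \<in> J \<and> c \<le> d} \<subseteq> Pow J0"
  by (auto simp: tsJ_def tsJ0_def)

lemma space_pre_measure: "space pre_measure = J0"
  unfolding pre_measure_def by (rule space_extend_measure[OF intervals_subset])

lemma sets_pre_measure: "sets pre_measure =
    sigma_sets J0 ((\<lambda>(c, d). {c..<d} \<inter> T) ` {(c, d). c \<in> J \<and> d \<in> J \<and> c \<le> d})"
  unfolding pre_measure_def by (rule sets_extend_measure[OF intervals_subset])

lemma space_delta_measure: "space \<Delta> = J0"
  by (simp add: delta_measure_eq space_pre_measure)

sublocale complete_measure \<Delta>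
  unfolding delta_measure_eq by (rule completion.complete_measure_axioms)

lemma interval_in_pre_measure: "c \<in> J \<Longrightarrow> d \<in> J \<Longrightarrow> c \<le> d \<Longrightarrow> {c..<d} \<inter> T \<in> sets pre_measure"
  unfolding sets_pre_measure by (rule sigma_sets.Basic) auto

lemma emeasure_pre_measure:
  assumes "c \<in> J" and "d \<in> J" and "c \<le> d"
  shows "emeasure pre_measure ({c..<d} \<inter> T) = ennreal (d - c)"
proof -
  text \<open>The measure is the image of the Lebesgue measure under the map sending \<open>x\<close> to the last
    point of \<open>T\<close> before it.\<close>
  define r where "r x = Sup (T \<inter> {a..x})" for x
  define L where "L = restrict_space lborel {a..<b}"
  have r: "r x \<in> T" "a \<le> r x" "r x \<le> x" if "a \<le> x" for x
  proof -
    have ne: "T \<inter> {a..x} \<noteq> {}" using that a_in by auto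
    have "r x \<in> T \<inter> {a..x}" unfolding r_def
      by (rule closed_contains_Sup[OF ne]) (auto intro: closed_Int closed_T)
    then show "r x \<in> T" "a \<le> r x" "r x \<le> x" by auto
  qed
  \<comment> \<open>For a threshold in \<open>J\<close> the conditions on \<open>r x\<close> and on
    \<open>x\<close> coincide. Hence the preimage of \<open>{c..<d} \<inter> T\<close> is the whole
    interval \<open>{c..<d}\<close>, whose length is the prescribed value.\<close>
  have le_r: "c \<le> r x \<longleftrightarrow> c \<le> x" if "c \<in> J" "a \<le> x" for c x
  proof
    assume "c \<le> x"
    then show "c \<le> r x" unfolding r_def using that
      by (intro cSup_upper) (auto simp: tsJ_def)
  qed (use r(3)[OF that(2)] in auto)
  have vim: "r -` ({c..<d} \<inter> T) \<inter> {a..<b} = {c..<d}" if "c \<in> J" "d \<in> J" for c d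
  proof -
    have "x \<in> r -` ({c..<d} \<inter> T) \<inter> {a..<b} \<longleftrightarrow> x \<in> {c..<d}" for x
      using that r[of x] le_r[of c x] le_r[of d x] by (auto simp: tsJ_def)
    then show ?thesis by blast
  qed
  have spL: "space L = {a..<b}" by (simp add: L_def space_restrict_space)
  have sub: "{c..<d} \<in> sets L" if "c \<in> J" "d \<in> J" for c d
    using that by (auto simp: L_def sets_restrict_space_iff tsJ_def)
  have meas: "r \<in> measurable L pre_measure"
  proof (rule measurable_sigma_sets[OF sets_pre_measure])
    show "r \<in> space L \<rightarrow> J0" using r by (force simp: spL tsJ0_def)
  qed (use intervals_subset vim sub in \<open>auto simp: spL\<close>)
  have "emeasure (distr L pre_measure r) ({c..<d} \<inter> T) = ennreal (d - c)"
    if cd: "c \<in> J" "d \<in> J" "c \<le> d" for c d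
  proof -
    have "emeasure (distr L pre_measure r) ({c..<d} \<inter> T) = emeasure L {c..<d}"
      using emeasure_distr[OF meas interval_in_pre_measure[OF cd]] by (simp only: spL vim[OF cd(1,2)])
    then show ?thesis
      using cd by (simp add: L_def emeasure_restrict_space tsJ_def)
  qed
  \<comment> \<open>Some measure with the prescribed values must exist for
    \<open>extend_measure\<close> to attain them; the image measure is this witness.\<close>
  then show ?thesis
    using emeasure_extend_measure[OF pre_measure_def, of "emeasure (distr L pre_measure r)" "(c, d)"]
      intervals_subset assms emeasure_positive[of "distr L pre_measure r"]
      emeasure_countably_additive[of "distr L pre_measure r"]
    by auto
qed

section \<open>Finiteness, measurable sets and separability of the delta measure\<close>

lemma J0_eq: "J0 = {a..<b} \<inter> T"
  by (simp add: tsJ0_def)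

lemma ends_in_J: "a \<in> J" "b \<in> J"
  using a_in b_in a_less_b by (auto simp: tsJ_def)

lemma finite_measure_delta_measure: "finite_measure \<Delta>"
proof
  have "emeasure pre_measure J0 = ennreal (b - a)"
    using emeasure_pre_measure[of a b] ends_in_J a_less_b by (simp add: J0_eq)
  then show "emeasure \<Delta> (space \<Delta>) \<noteq> \<infinity>"
    using sets.top[of pre_measure] by (simp add: delta_measure_eq space_pre_measure)
qed

text \<open>The generating intervals have end points in \<open>J\<close>. Replacing a real threshold
  \<open>q\<close> by the first point of the time scale at or after it does not change which points
  of \<open>J\<close> lie below.\<close>

lemma first_point_after:
  assumes "a \<le> q" and "q \<le> b"
  obtains d where "d \<in> J" "q \<le> d" "\<And>x. x \<in> J \<Longrightarrow> x < d \<Longrightarrow> x < q"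
proof
  define d where "d = Inf (T \<inter> {q..b})"
  have ne: "T \<inter> {q..b} \<noteq> {}" using assms b_in by auto
  have "d \<in> T \<inter> {q..b}" unfolding d_def
    by (rule closed_contains_Inf[OF ne]) (auto intro: closed_Int closed_T)
  then show "d \<in> J" "q \<le> d" using assms by (auto simp: tsJ_def)
  show "x < q" if x: "x \<in> J" "x < d" for x
  proof (rule ccontr)
    assume "\<not> x < q"
    then have "d \<le> x" unfolding d_def using x by (intro cInf_lower) (auto simp: tsJ_def)
    then show False using x by simp
  qed
qed

lemma id_measurable_pre_measure: "(\<lambda>x. x) \<in> borel_measurable pre_measure"
proof (rule borel_measurableI_less)
  fix q :: real
  show "{x \<in> space pre_measure. x < q} \<in> sets pre_measure"
  proof (cases "q \<le> b")
    case True
    \<comment> \<open>The maximum covers \<open>q < a\<close>, where \<open>d = a\<close> and both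
      sets are empty.\<close>
    obtain d where d: "d \<in> J" "max q a \<le> d" "\<And>x. x \<in> J \<Longrightarrow> x < d \<Longrightarrow> x < max q a"
      using first_point_after[of "max q a"] True a_less_b by auto
    have "{x \<in> space pre_measure. x < q} = {a..<d} \<inter> T"
    proof -
      have "x \<in> J0 \<and> x < q \<longleftrightarrow> x \<in> {a..<d} \<inter> T" for x
        using d(1,2) d(3)[of x] by (auto simp: tsJ0_def tsJ_def)
      then show ?thesis unfolding space_pre_measure by blast
    qed
    then show ?thesis using interval_in_pre_measure[of a d] d ends_in_J by auto
  next
    case False
    then have "{x \<in> space pre_measure. x < q} = space pre_measure"
      by (auto simp: space_pre_measure tsJ0_def)
    then show ?thesis by simp
  qed
qed

lemma pre_measure_borel:
  assumes "A \<in> sets pre_measure"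
  shows "A \<in> sets borel"
  using assms unfolding sets_pre_measure
proof (induction rule: sigma_sets.induct)
  case (Basic A)
  then show ?case using closed_T by auto
next
  case (Compl A)
  then show ?case using closed_T by (auto simp: J0_eq)
qed auto

text \<open>A set of the completion differs from its main part by a null set, and the main part is
  Borel because \<open>T\<close> is closed.\<close>

lemma delta_Lp_countable_dense:
  assumes "0 < p"
  shows "\<exists>S :: (real \<Rightarrow> 'v::{banach,second_countable_topology}) set.
    countable S \<and> S \<subseteq> Lp_space p \<Delta> \<and> Lp_closure p \<Delta> S = Lp_space p \<Delta>"
proof (rule Lp_countable_dense[OF finite_measure_delta_measure _ _ assms])
  show "(\<lambda>x. x) \<in> borel_measurable \<Delta>"
    unfolding delta_measure_eq by (rule measurable_completion[OF id_measurable_pre_measure])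
  fix A assume A: "A \<in> sets \<Delta>"
  then have A': "A \<in> sets (completion pre_measure)" by (simp add: delta_measure_eq)
  have "AE x in \<Delta>. x \<in> A \<longleftrightarrow> x \<in> main_part pre_measure A"
    unfolding delta_measure_eq using AE_completion[OF AE_in_main_part[OF A']]
    by eventually_elim auto
  then show "\<exists>B\<in>sets borel. AE x in \<Delta>. x \<in> A \<longleftrightarrow> x \<in> B"
    using pre_measure_borel[OF main_part_sets[OF A']] by blast
qed

text \<open>A right neighbourhood of \<open>t\<close> contains \<open>{t..<d} \<inter> T\<close>, of
  measure \<open>d - t > 0\<close>, where \<open>d\<close> is the first point at or after some
  \<open>q > t\<close>. If \<open>t\<close> is right-scattered, \<open>d\<close> may lie beyond
  \<open>t + \<delta>\<close>, but no point of the set reaches \<open>q\<close>.\<close>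

lemma AE_delta_right_dense:
  assumes P: "AE x in \<Delta>. P x" and t: "t \<in> J0" and \<delta>: "0 < \<delta>"
  shows "\<exists>x\<in>J0. t \<le> x \<and> x < t + \<delta> \<and> P x"
proof (rule ccontr)
  assume neg: "\<not> ?thesis"
  define q where "q = min (t + \<delta> / 2) b"
  have t': "a \<le> t" "t < b" "t \<in> J" using t by (auto simp: tsJ0_def tsJ_def)
  have q: "t < q" "a \<le> q" "q \<le> b" "q < t + \<delta>" using t' \<delta> by (auto simp: q_def min_def)
  obtain d where d: "d \<in> J" "q \<le> d" "\<And>x. x \<in> J \<Longrightarrow> x < d \<Longrightarrow> x < q"
    using first_point_after[OF q(2,3)] by blast
  have "\<not> P x" if x: "x \<in> {t..<d} \<inter> T" for x
  proof -
    have "x \<in> J0" "x \<in> J" using x d(1) t' by (auto simp: tsJ_def tsJ0_def)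
    moreover have "x < q" using d(3)[OF \<open>x \<in> J\<close>] x by auto
    ultimately show ?thesis using neg x q by fastforce
  qed
  then have "AE x in \<Delta>. x \<notin> {t..<d} \<inter> T"
    using P by (auto elim!: eventually_mono)
  moreover have s: "{t..<d} \<inter> T \<in> sets pre_measure"
    using t' d q by (intro interval_in_pre_measure) auto
  ultimately have "emeasure \<Delta> ({t..<d} \<inter> T) = 0"
    by (subst (asm) AE_iff_measurable[where N = "{t..<d} \<inter> T"])
      (use sets.sets_into_space[OF s] in \<open>auto simp: delta_measure_eq\<close>)
  moreover have "emeasure \<Delta> ({t..<d} \<inter> T) = ennreal (d - t)"
    using emeasure_pre_measure[of t d] t' d q s by (simp add: delta_measure_eq)
  ultimately show False using d q by (simp add: ennreal_eq_0_iff)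
qed

end

section \<open>Delta derivatives\<close>

text \<open>Any point \<open>s\<close> near \<open>t\<close> other than the jump of \<open>t\<close>
  contradicts the defining inequality for \<epsilon> = \<open>norm D / 2\<close>. The value at
  \<open>t\<close> is a separate assumption because \<open>at t within S\<close> leaves out
  \<open>t\<close>.\<close>

lemma delta_deriv_zero_unique:
  assumes D: "has_delta_deriv S f D t" and t: "\<exists>s\<in>S. t < s"
    and 0: "f t = 0" "f (fwd_jump S t) = 0" "\<forall>\<^sub>F s in at t within S. f s = 0"
  shows "D = 0"
proof (rule ccontr)
  assume "D \<noteq> 0"
  let ?\<sigma> = "fwd_jump S t"
  obtain \<delta> where \<delta>: "0 < \<delta>" and *: "\<And>s. s \<in> S \<Longrightarrow> \<bar>s - t\<bar> < \<delta> \<Longrightarrow>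
      norm (f ?\<sigma> - f s - (?\<sigma> - s) *\<^sub>R D) \<le> norm D / 2 * \<bar>?\<sigma> - s\<bar>"
    using D \<open>D \<noteq> 0\<close> unfolding has_delta_deriv_def by (meson half_gt_zero zero_less_norm_iff)
  obtain \<eta> where \<eta>: "0 < \<eta>" and f0: "\<And>s. s \<in> S \<Longrightarrow> \<bar>s - t\<bar> < \<eta> \<Longrightarrow> f s = 0"
    using 0(1,3) unfolding eventually_at by (metis dist_real_def)
  \<comment> \<open>If the jump of \<open>t\<close> is \<open>t\<close>, it is an infimum approached
    from the right; otherwise \<open>t\<close> itself differs from its jump.\<close>
  have "\<exists>s\<in>S. \<bar>s - t\<bar> < min \<delta> \<eta> \<and> s \<noteq> ?\<sigma>"
  proof (cases "?\<sigma> = t")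
    case True
    then have "Inf {s\<in>S. t < s} < t + min \<delta> \<eta>"
      using t \<delta> \<eta> by (auto simp: fwd_jump_def split: if_splits)
    then obtain s where "s \<in> S" "t < s" "s < t + min \<delta> \<eta>"
      using cInf_lessD[of "{s\<in>S. t < s}" "t + min \<delta> \<eta>"] t by auto
    then show ?thesis using True by (intro bexI[of _ s]) auto
  next
    case False
    then show ?thesis using D \<delta> \<eta> by (intro bexI[of _ t]) (auto simp: has_delta_deriv_def)
  qed
  then obtain s where s: "s \<in> S" "\<bar>s - t\<bar> < \<delta>" "\<bar>s - t\<bar> < \<eta>" "s \<noteq> ?\<sigma>" by auto
  have "norm ((?\<sigma> - s) *\<^sub>R D) \<le> norm D / 2 * \<bar>?\<sigma> - s\<bar>"
    using *[OF s(1,2)] f0[OF s(1,3)] 0(2) by simp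
  then have "norm D * \<bar>?\<sigma> - s\<bar> \<le> norm D / 2 * \<bar>?\<sigma> - s\<bar>" by (simp add: mult.commute)
  then show False using s(4) \<open>D \<noteq> 0\<close> by (simp add: mult_le_cancel_right)
qed

text \<open>The combination is required only at \<open>t\<close>, at its jump and near
  \<open>t\<close>, since a fractional integral may fail to exist elsewhere.\<close>

lemma has_delta_deriv_lincomb:
  assumes f: "has_delta_deriv S f D t" and g: "has_delta_deriv S g E t"
    and h: "h t = c *\<^sub>R f t + d *\<^sub>R g t"
      "h (fwd_jump S t) = c *\<^sub>R f (fwd_jump S t) + d *\<^sub>R g (fwd_jump S t)"
      "\<forall>\<^sub>F s in at t within S. h s = c *\<^sub>R f s + d *\<^sub>R g s"
  shows "has_delta_deriv S h (c *\<^sub>R D + d *\<^sub>R E) t"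
  unfolding has_delta_deriv_def
proof (intro conjI allI impI)
  show "t \<in> S" using f by (simp add: has_delta_deriv_def)
  let ?\<sigma> = "fwd_jump S t"
  fix \<epsilon> :: real assume \<epsilon>: "0 < \<epsilon>"
  \<comment> \<open>The summand 1 keeps the denominator positive when
    \<open>c = d = 0\<close>.\<close>
  define e where "e = \<epsilon> / (\<bar>c\<bar> + \<bar>d\<bar> + 1)"
  have pos: "0 < \<bar>c\<bar> + \<bar>d\<bar> + 1" by linarith
  have e: "0 < e" using \<epsilon> pos by (simp add: e_def)
  obtain \<delta>1 where \<delta>1: "0 < \<delta>1" "\<And>s. s \<in> S \<Longrightarrow> \<bar>s - t\<bar> < \<delta>1 \<Longrightarrow>
      norm (f ?\<sigma> - f s - (?\<sigma> - s) *\<^sub>R D) \<le> e * \<bar>?\<sigma> - s\<bar>"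
    using f e unfolding has_delta_deriv_def by blast
  obtain \<delta>2 where \<delta>2: "0 < \<delta>2" "\<And>s. s \<in> S \<Longrightarrow> \<bar>s - t\<bar> < \<delta>2 \<Longrightarrow>
      norm (g ?\<sigma> - g s - (?\<sigma> - s) *\<^sub>R E) \<le> e * \<bar>?\<sigma> - s\<bar>"
    using g e unfolding has_delta_deriv_def by blast
  obtain \<eta> where \<eta>: "0 < \<eta>" "\<And>s. s \<in> S \<Longrightarrow> \<bar>s - t\<bar> < \<eta> \<Longrightarrow> h s = c *\<^sub>R f s + d *\<^sub>R g s"
    using h(1,3) unfolding eventually_at by (metis dist_real_def)
  show "\<exists>\<delta>>0. \<forall>s\<in>S. \<bar>s - t\<bar> < \<delta> \<longrightarrow>
      norm (h ?\<sigma> - h s - (?\<sigma> - s) *\<^sub>R (c *\<^sub>R D + d *\<^sub>R E)) \<le> \<epsilon> * \<bar>?\<sigma> - s\<bar>"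
  proof (intro exI[of _ "min \<eta> (min \<delta>1 \<delta>2)"] conjI ballI impI)
    fix s assume s: "s \<in> S" "\<bar>s - t\<bar> < min \<eta> (min \<delta>1 \<delta>2)"
    let ?F = "f ?\<sigma> - f s - (?\<sigma> - s) *\<^sub>R D" and ?G = "g ?\<sigma> - g s - (?\<sigma> - s) *\<^sub>R E"
    have "h ?\<sigma> - h s - (?\<sigma> - s) *\<^sub>R (c *\<^sub>R D + d *\<^sub>R E) = c *\<^sub>R ?F + d *\<^sub>R ?G"
      using h(2) \<eta>(2)[OF s(1)] s(2) by (simp add: algebra_simps)
    then have "norm (h ?\<sigma> - h s - (?\<sigma> - s) *\<^sub>R (c *\<^sub>R D + d *\<^sub>R E))
        \<le> \<bar>c\<bar> * norm ?F + \<bar>d\<bar> * norm ?G"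
      by (metis norm_scaleR norm_triangle_ineq)
    also have "\<dots> \<le> \<bar>c\<bar> * (e * \<bar>?\<sigma> - s\<bar>) + \<bar>d\<bar> * (e * \<bar>?\<sigma> - s\<bar>)"
      using s \<delta>1(2)[OF s(1)] \<delta>2(2)[OF s(1)] by (intro add_mono mult_left_mono) auto
    also have "\<dots> \<le> (\<bar>c\<bar> + \<bar>d\<bar> + 1) * (e * \<bar>?\<sigma> - s\<bar>)"
      using e by (simp add: algebra_simps)
    also have "\<dots> = \<epsilon> * \<bar>?\<sigma> - s\<bar>" using pos by (simp add: e_def)
    finally show "norm (h ?\<sigma> - h s - (?\<sigma> - s) *\<^sub>R (c *\<^sub>R D + d *\<^sub>R E)) \<le> \<epsilon> * \<bar>?\<sigma> - s\<bar>" .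
  qed (use \<eta> \<delta>1 \<delta>2 in auto)
qed

text \<open>\<open>R\<close> may be larger than the common domain of the summands: the integral of a
  combination can exist where theirs do not.\<close>

lemma has_partial_delta_deriv_lincomb:
  assumes f: "has_partial_delta_deriv S P f D t" and g: "has_partial_delta_deriv S Q g E t"
    and R: "\<And>s. P s \<Longrightarrow> Q s \<Longrightarrow> R s" and h: "\<And>s. P s \<Longrightarrow> Q s \<Longrightarrow> h s = c *\<^sub>R f s + d *\<^sub>R g s"
  shows "has_partial_delta_deriv S R h (c *\<^sub>R D + d *\<^sub>R E) t"
proof -
  have PQ: "\<forall>\<^sub>F s in at t within S. P s \<and> Q s"
    using f g by (auto simp: has_partial_delta_deriv_def intro: eventually_conj)
  then have "\<forall>\<^sub>F s in at t within S. R s" "\<forall>\<^sub>F s in at t within S. h s = c *\<^sub>R f s + d *\<^sub>R g s"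
    using R h by (auto elim!: eventually_mono)
  then show ?thesis
    using f g R h unfolding has_partial_delta_deriv_def
    by (auto intro: has_delta_deriv_lincomb)
qed

lemma has_partial_delta_deriv_zero_unique:
  assumes D: "has_partial_delta_deriv S P f D t" and t: "\<exists>s\<in>S. t < s"
    and f: "\<And>s. P s \<Longrightarrow> f s = 0"
  shows "D = 0"
proof (rule delta_deriv_zero_unique[OF _ t])
  show "\<forall>\<^sub>F s in at t within S. f s = 0"
    using D f by (auto simp: has_partial_delta_deriv_def elim!: eventually_mono)
qed (use D f in \<open>auto simp: has_partial_delta_deriv_def\<close>)

lemma has_partial_delta_deriv_unique:
  assumes "has_partial_delta_deriv S P f D t" and "has_partial_delta_deriv S P f E t"
    and "\<exists>s\<in>S. t < s"
  shows "D = E"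
proof -
  have "has_partial_delta_deriv S P (\<lambda>s. 0) (1 *\<^sub>R D + (- 1) *\<^sub>R E) t"
    by (rule has_partial_delta_deriv_lincomb[OF assms(1,2)]) auto
  from has_partial_delta_deriv_zero_unique[OF this assms(3)] show ?thesis by simp
qed

section \<open>Riemann--Liouville derivatives\<close>

lemma right_int_lincomb:
  assumes "right_int_exists T a b \<beta> v t" and "right_int_exists T a b \<beta> w t"
  shows "right_int_exists T a b \<beta> (\<lambda>x. c *\<^sub>R v x + d *\<^sub>R w x) t"
    and "right_int T a b \<beta> (\<lambda>x. c *\<^sub>R v x + d *\<^sub>R w x) t
      = c *\<^sub>R right_int T a b \<beta> v t + d *\<^sub>R right_int T a b \<beta> w t"
proof -
  let ?M = "delta_measure T a b"
  let ?I = "\<lambda>u s. indicator ({t..<b} \<inter> T) s *\<^sub>R (RL_kernel \<beta> (s - fwd_jump T t) *\<^sub>R (u s :: real ^ 'a))"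
  have eq: "?I (\<lambda>x. c *\<^sub>R v x + d *\<^sub>R w x) = (\<lambda>s. c *\<^sub>R ?I v s + d *\<^sub>R ?I w s)"
    by (simp add: fun_eq_iff scaleR_add_right mult_ac)
  have i: "\<beta> \<noteq> 0 \<Longrightarrow> integrable ?M (?I v)" "\<beta> \<noteq> 0 \<Longrightarrow> integrable ?M (?I w)"
    using assms by (auto simp: right_int_exists_def set_integrable_def)
  then have "\<beta> \<noteq> 0 \<Longrightarrow> integrable ?M (\<lambda>s. c *\<^sub>R ?I v s + d *\<^sub>R ?I w s)"
    by (intro Bochner_Integration.integrable_add integrable_scaleR_right)
  then show "right_int_exists T a b \<beta> (\<lambda>x. c *\<^sub>R v x + d *\<^sub>R w x) t"
    unfolding right_int_exists_def set_integrable_def eq by blast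
  show "right_int T a b \<beta> (\<lambda>x. c *\<^sub>R v x + d *\<^sub>R w x) t
      = c *\<^sub>R right_int T a b \<beta> v t + d *\<^sub>R right_int T a b \<beta> w t"
    using i unfolding right_int_def set_lebesgue_integral_def eq by (simp del: scaleR_scaleR)
qed

lemma has_right_RL_deriv_cong_AE:
  assumes "AE t in delta_measure T a b. u t = u' t"
  shows "has_right_RL_deriv T a b \<alpha> u = has_right_RL_deriv T a b \<alpha> u'"
proof -
  have "(AE t in delta_measure T a b. v t = u t) \<longleftrightarrow> (AE t in delta_measure T a b. v t = u' t)" for v
    using assms by (auto elim: AE_mp)
  then show ?thesis by (simp add: has_right_RL_deriv_def fun_eq_iff)
qed

lemma has_right_RL_deriv_lincomb:
  assumes u: "has_right_RL_deriv T a b \<alpha> u g" and w: "has_right_RL_deriv T a b \<alpha> w h"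
  shows "has_right_RL_deriv T a b \<alpha> (\<lambda>t. c *\<^sub>R u t + d *\<^sub>R w t) (\<lambda>t. c *\<^sub>R g t + d *\<^sub>R h t)"
proof -
  let ?M = "delta_measure T a b" and ?J = "tsJ T a b"
  let ?D = "\<lambda>v. has_partial_delta_deriv ?J (right_int_exists T a b (1 - \<alpha>) v) (right_int T a b (1 - \<alpha>) v)"
  obtain v1 where v1: "AE t in ?M. v1 t = u t"
    "\<alpha> = 1 \<longrightarrow> continuous_on ?J v1 \<and> v1 b = v1 (bwd_jump ?J b)" "AE t in ?M. ?D v1 (- g t) t"
    using u unfolding has_right_RL_deriv_def by blast
  obtain v2 where v2: "AE t in ?M. v2 t = w t"
    "\<alpha> = 1 \<longrightarrow> continuous_on ?J v2 \<and> v2 b = v2 (bwd_jump ?J b)" "AE t in ?M. ?D v2 (- h t) t"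
    using w unfolding has_right_RL_deriv_def by blast
  let ?v = "\<lambda>t. c *\<^sub>R v1 t + d *\<^sub>R v2 t"
  show ?thesis
    unfolding has_right_RL_deriv_def
  proof (intro exI[of _ ?v] conjI impI)
    show "AE t in ?M. ?v t = c *\<^sub>R u t + d *\<^sub>R w t"
      using v1(1) v2(1) by eventually_elim simp
    show "AE t in ?M. ?D ?v (- (c *\<^sub>R g t + d *\<^sub>R h t)) t"
      using v1(3) v2(3)
    proof eventually_elim
      case (elim t)
      have "?D ?v (c *\<^sub>R (- g t) + d *\<^sub>R (- h t)) t"
        by (rule has_partial_delta_deriv_lincomb[OF elim]; rule right_int_lincomb)
      then show ?case by simp
    qed
  qed (use v1(2) v2(2) in \<open>auto intro!: continuous_intros\<close>)
qed

context time_scale_interval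
begin

lemma J0_less: "t \<in> J0 \<Longrightarrow> \<exists>s\<in>J. t < s"
  using ends_in_J by (auto simp: tsJ0_def)

text \<open>Zeros of \<open>v\<close> occur arbitrarily close to the right of every point of
  \<open>J0\<close>, so continuity gives zero there. Nothing lies to the right of \<open>b\<close>;
  its value is that at \<open>Sup J0\<close>, a point of the closure of \<open>J0\<close>, whether
  \<open>b\<close> is left-dense or left-scattered.\<close>

lemma continuous_AE_zero:
  fixes v :: "real \<Rightarrow> 'v::real_normed_vector"
  assumes cont: "continuous_on J v" and b: "v b = v (bwd_jump J b)"
    and zero: "AE t in \<Delta>. v t = 0" and t: "t \<in> J"
  shows "v t = 0"
proof -
  have 0: "v t = 0" if t: "t \<in> J0" for t
  proof (rule ccontr)
    assume "v t \<noteq> 0"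
    have tJ: "t \<in> J" using t by (auto simp: tsJ_def tsJ0_def)
    obtain \<delta> where \<delta>: "0 < \<delta>" "\<And>s. s \<in> J \<Longrightarrow> dist s t < \<delta> \<Longrightarrow> dist (v s) (v t) < norm (v t)"
      using cont tJ \<open>v t \<noteq> 0\<close> unfolding continuous_on_iff by (meson zero_less_norm_iff)
    obtain s where "s \<in> J0" "t \<le> s" "s < t + \<delta>" "v s = 0"
      using AE_delta_right_dense[OF zero t \<delta>(1)] by blast
    then have "dist (v s) (v t) < norm (v t)"
      by (intro \<delta>(2)) (auto simp: dist_real_def tsJ_def tsJ0_def)
    then show False using \<open>v s = 0\<close> by simp
  qed
  have tcases: "t = b \<or> t \<in> J0" using t by (auto simp: tsJ_def tsJ0_def)
  have "v b = 0"
  proof -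
    have cl: "closure J0 \<subseteq> J"
      by (rule closure_minimal) (use closed_T in \<open>auto simp: tsJ_def tsJ0_def intro: closed_Int\<close>)
    have ne: "J0 \<noteq> {}" using a_in a_less_b by (auto simp: tsJ0_def)
    have bdd: "bdd_above J0" by (auto simp: tsJ0_def intro!: bdd_aboveI[of _ b])
    have "{s \<in> J. s < b} = J0" by (auto simp: tsJ_def tsJ0_def)
    then have "bwd_jump J b = Sup J0" using ne by (simp add: bwd_jump_def)
    moreover have "Sup J0 \<in> closure J0" using ne bdd by (rule closure_contains_Sup)
    ultimately show ?thesis
      using continuous_constant_on_closure[of J0 v 0 "Sup J0"] continuous_on_subset[OF cont cl] 0 b
      by simp
  qed
  then show ?thesis using 0 tcases by auto
qed

text \<open>A representative \<open>v\<close> of zero may be nonzero on a null set, yet the function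
  to be differentiated vanishes at every point of \<open>J\<close>: for
  \<open>\<alpha> \<noteq> 1\<close> as an integral, for \<open>\<alpha> = 1\<close> by
  continuity.\<close>

lemma right_RL_deriv_zero:
  assumes "has_right_RL_deriv T a b \<alpha> (\<lambda>t. 0) g"
  shows "AE t in \<Delta>. g t = 0"
proof -
  obtain v where v: "AE t in \<Delta>. v t = 0"
    "\<alpha> = 1 \<longrightarrow> continuous_on J v \<and> v b = v (bwd_jump J b)"
    "AE t in \<Delta>. has_partial_delta_deriv J
        (right_int_exists T a b (1 - \<alpha>) v) (right_int T a b (1 - \<alpha>) v) (- g t) t"
    using assms unfolding has_right_RL_deriv_def by blast
  have int0: "right_int T a b (1 - \<alpha>) v s = 0" if s: "s \<in> J" for s
  proof (cases "\<alpha> = 1")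
    case True
    then show ?thesis using v continuous_AE_zero s by (auto simp: right_int_def)
  next
    case False
    have "AE x in \<Delta>. indicator ({s..<b} \<inter> T) x *\<^sub>R (RL_kernel (1 - \<alpha>) (x - fwd_jump T s) *\<^sub>R v x) = 0"
      using v(1) by eventually_elim simp
    then show ?thesis
      using False by (simp add: right_int_def set_lebesgue_integral_def integral_eq_zero_AE)
  qed
  show ?thesis
    using v(3) AE_space
  proof eventually_elim
    case (elim t)
    then have t: "t \<in> J0" by (simp add: space_delta_measure)
    have "has_delta_deriv J (right_int T a b (1 - \<alpha>) v) (- g t) t"
      using elim by (simp add: has_partial_delta_deriv_def)
    moreover have tJ: "t \<in> J" using t by (auto simp: tsJ_def tsJ0_def)
    \<comment> \<open>\<open>int0\<close> is available on \<open>J\<close> only, so the jump must be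
      shown to stay in \<open>J\<close>; this follows from closedness.\<close>
    moreover have "fwd_jump J t \<in> J"
    proof -
      have ne: "{s \<in> J. t < s} \<noteq> {}" using J0_less[OF t] by auto
      have "closed J" using closed_T by (auto simp: tsJ_def)
      have "Inf {s \<in> J. t < s} \<in> closure {s \<in> J. t < s}"
        using ne by (rule closure_contains_Inf) (auto intro!: bdd_belowI[of _ t])
      also have "\<dots> \<subseteq> J" by (rule closure_minimal[OF _ \<open>closed J\<close>]) auto
      finally show ?thesis using ne by (simp only: fwd_jump_def if_False)
    qed
    moreover have "\<forall>\<^sub>F s in at t within J. right_int T a b (1 - \<alpha>) v s = 0"
      unfolding eventually_at_filter using int0 by simp
    ultimately have "- g t = 0"
      by - (rule delta_deriv_zero_unique[OF _ J0_less[OF t] int0 int0])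
    then show ?case by simp
  qed
qed

text \<open>The two derivatives may come from different representatives of \<open>u\<close>, so
  pointwise uniqueness of delta derivatives does not apply directly; their difference is a
  derivative of zero.\<close>

lemma has_right_RL_deriv_unique:
  assumes "has_right_RL_deriv T a b \<alpha> u g" and "has_right_RL_deriv T a b \<alpha> u h"
  shows "AE t in \<Delta>. g t = h t"
proof -
  have "has_right_RL_deriv T a b \<alpha> (\<lambda>t. 0) (\<lambda>t. 1 *\<^sub>R g t + (- 1) *\<^sub>R h t)"
    using has_right_RL_deriv_lincomb[OF assms, of 1 "- 1"] by simp
  from right_RL_deriv_zero[OF this] show ?thesis by simp
qed

lemma has_left_RL_deriv_unique:
  assumes "has_left_RL_deriv T a b \<alpha> u g" and "has_left_RL_deriv T a b \<alpha> u h"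
  shows "AE t in \<Delta>. g t = h t"
  using assms[unfolded has_left_RL_deriv_def] AE_space
proof eventually_elim
  case (elim t)
  then show ?case
    by (intro has_partial_delta_deriv_unique[OF elim(1,2)] J0_less) (simp add: space_delta_measure)
qed

text \<open>The hypotheses may supply different left derivatives of the same test function. These
  agree a.e., and completeness gives the measurability needed to replace one by the other in the
  integral with \<open>v\<close>.\<close>

lemma has_weak_right_deriv_lincomb:
  assumes u: "has_weak_right_deriv T a b \<alpha> u g" and v: "has_weak_right_deriv T a b \<alpha> v h"
  shows "has_weak_right_deriv T a b \<alpha> (\<lambda>t. c *\<^sub>R u t + d *\<^sub>R v t) (\<lambda>t. c *\<^sub>R g t + d *\<^sub>R h t)"
  unfolding has_weak_right_deriv_def
proof
  fix \<phi> :: "real \<Rightarrow> real ^ 'a" assume \<phi>: "\<phi> \<in> Cc_rd_infinity T a b"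
  obtain \<phi>1 where 1: "has_left_RL_deriv T a b \<alpha> \<phi> \<phi>1" "integrable \<Delta> (\<lambda>t. u t \<bullet> \<phi>1 t)"
    "integrable \<Delta> (\<lambda>t. g t \<bullet> \<phi> t)" "(LINT t|\<Delta>. u t \<bullet> \<phi>1 t) = (LINT t|\<Delta>. g t \<bullet> \<phi> t)"
    using u \<phi> unfolding has_weak_right_deriv_def by blast
  obtain \<phi>2 where 2: "has_left_RL_deriv T a b \<alpha> \<phi> \<phi>2" "integrable \<Delta> (\<lambda>t. v t \<bullet> \<phi>2 t)"
    "integrable \<Delta> (\<lambda>t. h t \<bullet> \<phi> t)" "(LINT t|\<Delta>. v t \<bullet> \<phi>2 t) = (LINT t|\<Delta>. h t \<bullet> \<phi> t)"
    using v \<phi> unfolding has_weak_right_deriv_def by blast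
  have eq: "AE t in \<Delta>. v t \<bullet> \<phi>2 t = v t \<bullet> \<phi>1 t"
    using has_left_RL_deriv_unique[OF 1(1) 2(1)] by eventually_elim simp
  have m: "(\<lambda>t. v t \<bullet> \<phi>1 t) \<in> borel_measurable \<Delta>"
    by (rule measurable_cong_AE[OF borel_measurable_integrable[OF 2(2)] eq]) simp
  have i: "integrable \<Delta> (\<lambda>t. v t \<bullet> \<phi>1 t)"
    using integrable_cong_AE[OF borel_measurable_integrable[OF 2(2)] m eq] 2(2) by simp
  have j: "(LINT t|\<Delta>. v t \<bullet> \<phi>1 t) = (LINT t|\<Delta>. h t \<bullet> \<phi> t)"
    using integral_cong_AE[OF borel_measurable_integrable[OF 2(2)] m eq] 2(4) by simp
  show "\<exists>\<phi>'. has_left_RL_deriv T a b \<alpha> \<phi> \<phi>' \<and>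
      integrable \<Delta> (\<lambda>t. (c *\<^sub>R u t + d *\<^sub>R v t) \<bullet> \<phi>' t) \<and>
      integrable \<Delta> (\<lambda>t. (c *\<^sub>R g t + d *\<^sub>R h t) \<bullet> \<phi> t) \<and>
      (LINT t|\<Delta>. (c *\<^sub>R u t + d *\<^sub>R v t) \<bullet> \<phi>' t) = (LINT t|\<Delta>. (c *\<^sub>R g t + d *\<^sub>R h t) \<bullet> \<phi> t)"
    using 1 2(3) i j by (intro exI[of _ \<phi>1]) (simp add: inner_add_left)
qed

section \<open>Separability\<close>

definition sobolev_fun :: "real \<Rightarrow> real \<Rightarrow> (real \<Rightarrow> real ^ 'n) set" where
  "sobolev_fun \<alpha> p = {u \<in> Lp_fun T a b p. \<exists>g\<in>Lp_fun T a b p. has_weak_right_deriv T a b \<alpha> u g}"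

definition sobolev_modular :: "real \<Rightarrow> real \<Rightarrow> (real \<Rightarrow> real ^ 'n) \<Rightarrow> real" where
  "sobolev_modular \<alpha> p u = Lp_modular p \<Delta> u + Lp_modular p \<Delta> (right_RL_deriv T a b \<alpha> p u)"

lemma sobolev_modular_nonneg: "0 \<le> sobolev_modular \<alpha> p u"
  by (simp add: sobolev_modular_def Lp_modular_nonneg)

lemma Lp_fun_eq: "Lp_fun T a b p = Lp_space p \<Delta>"
  by (auto simp: Lp_fun_def Lp_space_def)

lemma Lp_norm_powr: "p \<noteq> 0 \<Longrightarrow> Lp_norm T a b p u powr p = Lp_modular p \<Delta> u"
  using Lp_modular_nonneg[of p \<Delta> u] by (simp add: Lp_norm_def Lp_modular_def powr_powr)

lemma Lp_space_lincomb:
  assumes "f \<in> Lp_space p M" and "g \<in> Lp_space p M" and "0 \<le> p"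
  shows "(\<lambda>x. c *\<^sub>R f x + d *\<^sub>R g x) \<in> Lp_space p M"
  using assms by (intro Lp_space_add Lp_space_scaleR)

lemma sobolev_fun_lincomb:
  assumes "u \<in> sobolev_fun \<alpha> p" and "v \<in> sobolev_fun \<alpha> p" and "0 \<le> p"
  shows "(\<lambda>t. c *\<^sub>R u t + d *\<^sub>R v t) \<in> sobolev_fun \<alpha> p"
proof -
  obtain g h where gh: "g \<in> Lp_space p \<Delta>" "has_weak_right_deriv T a b \<alpha> u g"
    "h \<in> Lp_space p \<Delta>" "has_weak_right_deriv T a b \<alpha> v h"
    using assms by (auto simp: sobolev_fun_def Lp_fun_eq)
  have "(\<lambda>t. c *\<^sub>R g t + d *\<^sub>R h t) \<in> Lp_space p \<Delta>"
    using gh assms(3) by (intro Lp_space_lincomb)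
  moreover have "(\<lambda>t. c *\<^sub>R u t + d *\<^sub>R v t) \<in> Lp_space p \<Delta>"
    using assms by (intro Lp_space_lincomb) (auto simp: sobolev_fun_def Lp_fun_eq)
  ultimately show ?thesis
    using has_weak_right_deriv_lincomb[OF gh(2,4), of c d] unfolding sobolev_fun_def Lp_fun_eq by blast
qed

text \<open>Passage from classes to functions: the norm selects an arbitrary element of the class,
  but both of its parts depend only on the class.\<close>

lemma sobolev_right_norm_class_diff:
  assumes u: "u \<in> sobolev_fun \<alpha> p" and v: "v \<in> sobolev_fun \<alpha> p" and p: "0 < p"
  shows "sobolev_right_norm T a b \<alpha> p (class_diff (ae_class T a b u) (ae_class T a b v))
    = sobolev_modular \<alpha> p (\<lambda>t. u t - v t) powr (1 / p)"
proof -
  let ?X = "class_diff (ae_class T a b u) (ae_class T a b v)"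
  define w where "w = (SOME w. w \<in> ?X)"
  have um: "u \<in> borel_measurable \<Delta>" and vm: "v \<in> borel_measurable \<Delta>"
    using u v by (auto simp: sobolev_fun_def Lp_fun_def)
  then have "(\<lambda>t. u t - v t) \<in> ?X"
    by (auto simp: class_diff_def ae_class_def)
  then have "w \<in> ?X" unfolding w_def by (rule someI[where P = "\<lambda>w. w \<in> ?X"])
  then obtain x y where w: "w = (\<lambda>t. x t - y t)" and x: "x \<in> ae_class T a b u" and y: "y \<in> ae_class T a b v"
    by (auto simp: class_diff_def)
  have wm: "w \<in> borel_measurable \<Delta>"
    using x y unfolding w ae_class_def by (auto intro: borel_measurable_diff)
  have eq: "AE t in \<Delta>. w t = u t - v t"
  proof -
    have "AE t in \<Delta>. x t = u t" "AE t in \<Delta>. y t = v t" using x y by (auto simp: ae_class_def)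
    then show ?thesis by eventually_elim (simp add: w)
  qed
  \<comment> \<open>The predicates under \<open>SOME\<close> coincide, so the selected derivatives
    are equal as functions, not just a.e.\<close>
  have "right_RL_deriv T a b \<alpha> p w = right_RL_deriv T a b \<alpha> p (\<lambda>t. u t - v t)"
    by (simp add: right_RL_deriv_def has_right_RL_deriv_cong_AE[OF eq])
  moreover have "Lp_modular p \<Delta> w = Lp_modular p \<Delta> (\<lambda>t. u t - v t)"
    by (rule Lp_modular_cong_AE[OF wm _ eq]) (use um vm in simp)
  ultimately show ?thesis
    using p by (simp add: sobolev_right_norm_def Let_def w_def[symmetric] Lp_norm_powr sobolev_modular_def)
qed

section \<open>The subspace of functions with a strong derivative in L^p\<close>

definition strong_fun :: "real \<Rightarrow> real \<Rightarrow> (real \<Rightarrow> real ^ 'n) set" where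
  "strong_fun \<alpha> p = {u. \<exists>g\<in>Lp_fun T a b p. has_right_RL_deriv T a b \<alpha> u g}"

lemma right_RL_deriv_strong:
  assumes "u \<in> strong_fun \<alpha> p"
  shows "right_RL_deriv T a b \<alpha> p u \<in> Lp_fun T a b p"
    and "has_right_RL_deriv T a b \<alpha> u (right_RL_deriv T a b \<alpha> p u)"
proof -
  have *: "\<exists>g. g \<in> Lp_fun T a b p \<and> has_right_RL_deriv T a b \<alpha> u g"
    using assms by (auto simp: strong_fun_def)
  then have "right_RL_deriv T a b \<alpha> p u = (SOME g. g \<in> Lp_fun T a b p \<and> has_right_RL_deriv T a b \<alpha> u g)"
    by (auto simp: right_RL_deriv_def)
  then show "right_RL_deriv T a b \<alpha> p u \<in> Lp_fun T a b p"
    and "has_right_RL_deriv T a b \<alpha> u (right_RL_deriv T a b \<alpha> p u)"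
    using someI_ex[OF *] by simp_all
qed

lemma right_RL_deriv_not_strong: "u \<notin> strong_fun \<alpha> p \<Longrightarrow> right_RL_deriv T a b \<alpha> p u = (\<lambda>t. 0)"
  by (auto simp: right_RL_deriv_def strong_fun_def)

text \<open>Linearity serves both cases: differences of elements stay in the subspace, and
  translating an element by a nonzero multiple of a function outside leaves it.\<close>

lemma strong_fun_lincomb:
  assumes "u \<in> strong_fun \<alpha> p" and "v \<in> strong_fun \<alpha> p" and "0 \<le> p"
  shows "(\<lambda>t. c *\<^sub>R u t + d *\<^sub>R v t) \<in> strong_fun \<alpha> p"
proof -
  obtain g h where gh: "g \<in> Lp_space p \<Delta>" "has_right_RL_deriv T a b \<alpha> u g"
    "h \<in> Lp_space p \<Delta>" "has_right_RL_deriv T a b \<alpha> v h"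
    using assms by (auto simp: strong_fun_def Lp_fun_eq)
  have "(\<lambda>t. c *\<^sub>R g t + d *\<^sub>R h t) \<in> Lp_space p \<Delta>"
    using gh assms(3) by (intro Lp_space_lincomb)
  then show ?thesis
    using has_right_RL_deriv_lincomb[OF gh(2,4), of c d] unfolding strong_fun_def Lp_fun_eq by blast
qed

text \<open>The equation holds only a.e. because \<open>SOME\<close> need not select
  linearly.\<close>

lemma right_RL_deriv_diff:
  assumes u: "u \<in> strong_fun \<alpha> p" and v: "v \<in> strong_fun \<alpha> p" and p: "0 \<le> p"
  shows "AE t in \<Delta>. right_RL_deriv T a b \<alpha> p (\<lambda>t. u t - v t) t
    = right_RL_deriv T a b \<alpha> p u t - right_RL_deriv T a b \<alpha> p v t"
proof -
  let ?D = "right_RL_deriv T a b \<alpha> p"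
  have "(\<lambda>t. u t - v t) \<in> strong_fun \<alpha> p"
    using strong_fun_lincomb[OF u v p, of 1 "- 1"] by simp
  then have "has_right_RL_deriv T a b \<alpha> (\<lambda>t. u t - v t) (?D (\<lambda>t. u t - v t))"
    by (rule right_RL_deriv_strong)
  moreover have "has_right_RL_deriv T a b \<alpha> (\<lambda>t. u t - v t) (\<lambda>t. ?D u t - ?D v t)"
    using has_right_RL_deriv_lincomb[OF right_RL_deriv_strong(2)[OF u] right_RL_deriv_strong(2)[OF v], of 1 "- 1"]
    by simp
  ultimately show ?thesis by (rule has_right_RL_deriv_unique)
qed

text \<open>With \<open>f\<close> the identity and \<open>g\<close> the derivative this is
  separability of a graph; with both the identity, of a subset of L^p. The approximating pairs from
  \<open>S \<times> S\<close> are replaced by elements of \<open>A\<close> through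
  \<open>countable_dense_subset\<close>.\<close>

lemma pair_countable_dense:
  fixes f g :: "'i \<Rightarrow> real \<Rightarrow> 'v::{banach,second_countable_topology}"
  assumes f: "\<And>x. x \<in> A \<Longrightarrow> f x \<in> Lp_space p \<Delta>" and g: "\<And>x. x \<in> A \<Longrightarrow> g x \<in> Lp_space p \<Delta>"
    and p: "0 < p"
  shows "\<exists>C\<subseteq>A. countable C \<and> (\<forall>x\<in>A. \<forall>e>0. \<exists>c\<in>C.
    Lp_modular p \<Delta> (\<lambda>t. f c t - f x t) + Lp_modular p \<Delta> (\<lambda>t. g c t - g x t) < e)"
proof -
  let ?m = "\<lambda>u v :: real \<Rightarrow> 'v. Lp_modular p \<Delta> (\<lambda>t. u t - v t)"
  obtain S :: "(real \<Rightarrow> 'v) set" where S: "countable S" "S \<subseteq> Lp_space p \<Delta>" "Lp_closure p \<Delta> S = Lp_space p \<Delta>"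
    using delta_Lp_countable_dense[OF p] by blast
  have ap: "\<exists>s\<in>S. ?m u s < e" if "u \<in> Lp_space p \<Delta>" "0 < e" for u e
    using that S(3) unfolding Lp_closure_def by blast
  have tri: "?m u v \<le> 2 powr p * (?m u s + ?m v s)"
    if "u \<in> Lp_space p \<Delta>" "v \<in> Lp_space p \<Delta>" "s \<in> S" for u v s
    using Lp_modular_triangle[of u p \<Delta> s v] that S(2) p Lp_modular_minus_commute[of p \<Delta> s v] by auto
  show ?thesis
  proof (rule countable_dense_subset[where S = "S \<times> S" and K = "2 powr p"
        and d = "\<lambda>x (s, s'). ?m (f x) s + ?m (g x) s'"])
    fix x and e :: real assume x: "x \<in> A" and "0 < e"
    then obtain s s' where "s \<in> S" "?m (f x) s < e / 2" "s' \<in> S" "?m (g x) s' < e / 2"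
      using ap[OF f[OF x], of "e / 2"] ap[OF g[OF x], of "e / 2"] by auto
    then show "\<exists>z\<in>S \<times> S. (case z of (s, s') \<Rightarrow> ?m (f x) s + ?m (g x) s') < e"
      by (intro bexI[of _ "(s, s')"]) auto
  next
    fix x y z assume xy: "x \<in> A" "y \<in> A" and z: "z \<in> S \<times> S"
    then obtain s s' where "z = (s, s')" "s \<in> S" "s' \<in> S" by auto
    then show "?m (f x) (f y) + ?m (g x) (g y) \<le> 2 powr p *
        ((case z of (s, s') \<Rightarrow> ?m (f x) s + ?m (g x) s') + (case z of (s, s') \<Rightarrow> ?m (f y) s + ?m (g y) s'))"
      using tri[OF f[OF xy(1)] f[OF xy(2)], of s] tri[OF g[OF xy(1)] g[OF xy(2)], of s']
      by (simp add: algebra_simps)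
  qed (use S in auto)
qed

text \<open>On \<open>strong_fun\<close> the derivative of \<open>c - u\<close> is a.e. the
  difference of the derivatives, which turns closeness on the graph into smallness of the
  modular.\<close>

lemma sobolev_countable_dense_strong:
  fixes \<alpha> p :: real
  assumes sub: "sobolev_fun \<alpha> p \<subseteq> (strong_fun \<alpha> p :: (real \<Rightarrow> real ^ 'n) set)" and p: "0 < p"
  shows "\<exists>C\<subseteq>sobolev_fun \<alpha> p :: (real \<Rightarrow> real ^ 'n) set. countable C \<and>
    (\<forall>u\<in>sobolev_fun \<alpha> p. \<forall>e>0. \<exists>c\<in>C. sobolev_modular \<alpha> p (\<lambda>t. c t - u t) < e)"
proof -
  let ?D = "right_RL_deriv T a b \<alpha> p :: (real \<Rightarrow> real ^ 'n) \<Rightarrow> _"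
  have "u \<in> Lp_space p \<Delta>" "?D u \<in> Lp_space p \<Delta>" if "u \<in> sobolev_fun \<alpha> p" for u
    using that sub right_RL_deriv_strong(1)[of u \<alpha> p] by (auto simp: sobolev_fun_def Lp_fun_eq)
  from pair_countable_dense[of "sobolev_fun \<alpha> p" "\<lambda>u. u" p ?D, OF this p]
  obtain C where C: "C \<subseteq> sobolev_fun \<alpha> p" "countable C" and
    dense: "\<forall>u\<in>sobolev_fun \<alpha> p. \<forall>e>0. \<exists>c\<in>C.
      Lp_modular p \<Delta> (\<lambda>t. c t - u t) + Lp_modular p \<Delta> (\<lambda>t. ?D c t - ?D u t) < e"
    by blast
  have eq: "sobolev_modular \<alpha> p (\<lambda>t. c t - u t)
      = Lp_modular p \<Delta> (\<lambda>t. c t - u t) + Lp_modular p \<Delta> (\<lambda>t. ?D c t - ?D u t)"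
    if "c \<in> C" "u \<in> sobolev_fun \<alpha> p" for c u
  proof -
    have s: "c \<in> strong_fun \<alpha> p" "u \<in> strong_fun \<alpha> p" using that C sub by auto
    have "(\<lambda>t. c t - u t) \<in> strong_fun \<alpha> p"
      using strong_fun_lincomb[OF s, of 1 "- 1"] p by simp
    then have "?D (\<lambda>t. c t - u t) \<in> borel_measurable \<Delta>" "?D c \<in> borel_measurable \<Delta>"
      "?D u \<in> borel_measurable \<Delta>"
      using s[THEN right_RL_deriv_strong(1)] right_RL_deriv_strong(1) by (auto simp: Lp_fun_def)
    then have "Lp_modular p \<Delta> (?D (\<lambda>t. c t - u t)) = Lp_modular p \<Delta> (\<lambda>t. ?D c t - ?D u t)"
      using s p by (intro Lp_modular_cong_AE right_RL_deriv_diff borel_measurable_diff) auto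
    then show ?thesis by (simp add: sobolev_modular_def)
  qed
  have "\<exists>c\<in>C. sobolev_modular \<alpha> p (\<lambda>t. c t - u t) < e" if u: "u \<in> sobolev_fun \<alpha> p" and e: "0 < e" for u e
  proof -
    obtain c where c: "c \<in> C"
      "Lp_modular p \<Delta> (\<lambda>t. c t - u t) + Lp_modular p \<Delta> (\<lambda>t. ?D c t - ?D u t) < e"
      using dense u e by blast
    show ?thesis using c(2) unfolding eq[OF c(1) u, symmetric] by (rule bexI[OF _ c(1)])
  qed
  then show ?thesis using C by blast
qed

text \<open>Off the subspace \<open>strong_fun \<alpha> p\<close> the derivative has its default value, so that only the
  \<open>L\<^sup>p\<close> part of the norm remains. One of the two approximants \<open>c\<close> and \<open>c + z / (n + 1)\<close> of \<open>u\<close>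
  differs from \<open>u\<close> by an element off this subspace.\<close>

lemma sobolev_countable_dense_not_strong:
  fixes z :: "real \<Rightarrow> real ^ 'n"
  assumes z: "z \<in> sobolev_fun \<alpha> p" "z \<notin> strong_fun \<alpha> p" and p: "1 \<le> p"
  shows "\<exists>C\<subseteq>sobolev_fun \<alpha> p :: (real \<Rightarrow> real ^ 'n) set. countable C \<and>
    (\<forall>u\<in>sobolev_fun \<alpha> p. \<forall>e>0. \<exists>c\<in>C. sobolev_modular \<alpha> p (\<lambda>t. c t - u t) < e)"
proof -
  let ?W = "sobolev_fun \<alpha> p :: (real \<Rightarrow> real ^ 'n) set"
  have W: "u \<in> Lp_space p \<Delta>" if "u \<in> ?W" for u
    using that by (auto simp: sobolev_fun_def Lp_fun_eq)
  have "0 < p" using p by simp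
  \<comment> \<open>Both components are the identity: \<open>B\<close> approximates in L^p only,
    without control of derivatives.\<close>
  from pair_countable_dense[of ?W "\<lambda>u. u" p "\<lambda>u. u", OF W W this]
  obtain B where B: "B \<subseteq> ?W" "countable B" and
    dense2: "\<forall>u\<in>?W. \<forall>e>0. \<exists>c\<in>B.
      Lp_modular p \<Delta> (\<lambda>t. c t - u t) + Lp_modular p \<Delta> (\<lambda>t. c t - u t) < e"
    by blast
  have dense: "\<exists>c\<in>B. Lp_modular p \<Delta> (\<lambda>t. c t - u t) < e" if u: "u \<in> ?W" and e: "0 < e" for u e
  proof -
    obtain c where "c \<in> B" "Lp_modular p \<Delta> (\<lambda>t. c t - u t) + Lp_modular p \<Delta> (\<lambda>t. c t - u t) < e"
      using dense2 u e by blast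
    then show ?thesis using Lp_modular_nonneg[of p \<Delta> "\<lambda>t. c t - u t"] by (intro bexI[of _ c]) auto
  qed
  define shift where "shift n c t = c t + inverse (real (Suc n)) *\<^sub>R z t" for n c t
  define C where "C = B \<union> (\<lambda>(n, c). shift n c) ` (UNIV \<times> B)"
  have "countable C" using B by (auto simp: C_def)
  moreover have "C \<subseteq> ?W"
  proof -
    have "shift n c \<in> ?W" if "c \<in> B" for n c
      using sobolev_fun_lincomb[of c \<alpha> p z 1 "inverse (real (Suc n))"] that B z p
      by (auto simp: shift_def[abs_def])
    then show ?thesis using B by (auto simp: C_def)
  qed
  moreover have "\<exists>c\<in>C. sobolev_modular \<alpha> p (\<lambda>t. c t - u t) < e" if u: "u \<in> ?W" and e: "0 < e" for u e
  proof -
    define k where "k = e / (2 * 2 powr p)"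
    have k: "0 < k" using e by (simp add: k_def)
    define Z where "Z = Lp_modular p \<Delta> z"
    have Z: "0 \<le> Z" by (simp add: Z_def Lp_modular_nonneg)
    obtain n where n: "inverse (real (Suc n)) < k / (Z + 1)"
      using reals_Archimedean[of "k / (Z + 1)"] k Z by auto
    let ?q = "inverse (real (Suc n))"
    have q: "0 < ?q" "?q \<le> 1" by (auto simp: inverse_le_1_iff)
    have qz: "Lp_modular p \<Delta> (\<lambda>t. ?q *\<^sub>R z t) < k"
    proof -
      have "Lp_modular p \<Delta> (\<lambda>t. ?q *\<^sub>R z t) = ?q powr p * Z"
        by (simp add: Lp_modular_scaleR Z_def)
      \<comment> \<open>Here \<open>?q powr p <= ?q\<close> because \<open>?q <= 1\<close> and
        \<open>1 <= p\<close>, so the linear bound on \<open>?q\<close> suffices; the summand 1 in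
        that bound covers \<open>Z = 0\<close>.\<close>
      also have "\<dots> \<le> ?q * Z"
        using powr_mono'[of 1 p ?q] q p Z by (intro mult_right_mono) auto
      also have "\<dots> \<le> k / (Z + 1) * Z" using n Z by (intro mult_right_mono) auto
      also have "\<dots> < k" using k Z by (simp add: field_simps)
      finally show ?thesis .
    qed
    obtain c where c: "c \<in> B" "Lp_modular p \<Delta> (\<lambda>t. c t - u t) < k" using dense[OF u k] by blast
    have cu: "(\<lambda>t. c t - u t) \<in> Lp_space p \<Delta>"
      using W[OF u] W[of c] c B p by (intro Lp_space_diff) auto
    have two: "1 \<le> 2 powr p" using p by (intro ge_one_powr_ge_zero) auto
    have le: "Lp_modular p \<Delta> (\<lambda>t. c t - u t) < e"
    proof -
      have "k * 1 \<le> k * (2 * 2 powr p)" using k two by (intro mult_left_mono) auto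
      also have "\<dots> = e" by (simp add: k_def)
      finally show ?thesis using c by simp
    qed
    have le': "Lp_modular p \<Delta> (\<lambda>t. shift n c t - u t) < e"
    proof -
      have "Lp_modular p \<Delta> (\<lambda>t. shift n c t - u t) = Lp_modular p \<Delta> (\<lambda>t. (c t - u t) + ?q *\<^sub>R z t)"
        by (simp add: shift_def algebra_simps)
      also have "\<dots> \<le> 2 powr p * (Lp_modular p \<Delta> (\<lambda>t. c t - u t) + Lp_modular p \<Delta> (\<lambda>t. ?q *\<^sub>R z t))"
        using p W[OF z(1)] cu by (intro Lp_space_add Lp_space_scaleR) auto
      also have "\<dots> < 2 powr p * (k + k)"
        using c qz by (intro mult_strict_left_mono add_strict_mono) auto
      also have "\<dots> = e" by (simp add: k_def)
      finally show ?thesis .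
    qed
    have mod: "sobolev_modular \<alpha> p w = Lp_modular p \<Delta> w" if "w \<notin> strong_fun \<alpha> p" for w :: "real \<Rightarrow> real ^ 'n"
      using p by (simp add: sobolev_modular_def right_RL_deriv_not_strong[OF that] Lp_modular_def)
    show ?thesis
    proof (cases "(\<lambda>t. c t - u t) \<in> strong_fun \<alpha> p")
      case True
      have "(\<lambda>t. shift n c t - u t) \<notin> strong_fun \<alpha> p"
      proof
        assume "(\<lambda>t. shift n c t - u t) \<in> strong_fun \<alpha> p"
        \<comment> \<open>The two differences themselves differ by \<open>z / (n + 1)\<close>, so
          these coefficients recover \<open>z\<close>.\<close>
        from strong_fun_lincomb[OF this True, of "real (Suc n)" "- real (Suc n)"] p
        have "(\<lambda>t. real (Suc n) *\<^sub>R (shift n c t - u t) + (- real (Suc n)) *\<^sub>R (c t - u t)) \<in> strong_fun \<alpha> p"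
          by simp
        also have "(\<lambda>t. real (Suc n) *\<^sub>R (shift n c t - u t) + (- real (Suc n)) *\<^sub>R (c t - u t)) = z"
        proof
          fix t
          have "real (Suc n) *\<^sub>R (shift n c t - u t) + (- real (Suc n)) *\<^sub>R (c t - u t)
              = real (Suc n) *\<^sub>R (?q *\<^sub>R z t)"
            by (simp only: shift_def scaleR_minus_left scaleR_diff_right scaleR_add_right) simp
          then show "real (Suc n) *\<^sub>R (shift n c t - u t) + (- real (Suc n)) *\<^sub>R (c t - u t) = z t"
            by simp
        qed
        finally show False using z(2) by contradiction
      qed
      then show ?thesis
        using c le' mod by (intro bexI[of _ "shift n c"]) (auto simp: C_def)
    next
      case False
      then show ?thesis using c le mod by (intro bexI[of _ c]) (auto simp: C_def)
    qed
  qed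
  ultimately show ?thesis by blast
qed

lemma separable_sobolev_right:
  fixes \<alpha> p :: real
  assumes p: "1 \<le> p"
  shows "separable_space (sobolev_right_topology T a b \<alpha> p :: (real \<Rightarrow> real ^ 'n) set topology)"
proof -
  let ?X = "sobolev_right_topology T a b \<alpha> p :: (real \<Rightarrow> real ^ 'n) set topology"
  let ?W = "sobolev_fun \<alpha> p :: (real \<Rightarrow> real ^ 'n) set"
  have "\<exists>C\<subseteq>?W. countable C \<and>
      (\<forall>u\<in>?W. \<forall>e>0. \<exists>c\<in>C. sobolev_modular \<alpha> p (\<lambda>t. c t - u t) < e)"
  proof (cases "?W \<subseteq> strong_fun \<alpha> p")
    case True
    then show ?thesis using p by (intro sobolev_countable_dense_strong) auto
  next
    case False
    then obtain z where "z \<in> ?W" "z \<notin> strong_fun \<alpha> p" by blast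
    then show ?thesis using p by (rule sobolev_countable_dense_not_strong)
  qed
  then obtain C where C: "C \<subseteq> ?W" "countable C" and
    dense: "\<forall>u\<in>?W. \<forall>e>0. \<exists>c\<in>C. sobolev_modular \<alpha> p (\<lambda>t. c t - u t) < e"
    by blast
  have W: "sobolev_right T a b \<alpha> p = ae_class T a b ` ?W"
    by (simp add: sobolev_right_def sobolev_fun_def)
  have "?X closure_of (ae_class T a b ` C) = topspace ?X"
  proof (rule subset_antisym[OF closure_of_subset_topspace], rule subsetI)
    fix X assume "X \<in> topspace ?X"
    then obtain u where u: "u \<in> ?W" "X = ae_class T a b u"
      by (auto simp: topspace_sobolev_right_topology W)
    show "X \<in> ?X closure_of (ae_class T a b ` C)"
      unfolding in_closure_of
    proof (intro conjI allI impI)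
      show "X \<in> topspace ?X" by fact
      \<comment> \<open>An open set contains, by definition of the topology, all members within some
        \<open>r\<close> of \<open>X\<close>. Approximation with arbitrarily small norm of the
        difference is therefore enough, whether or not the balls are open.\<close>
      fix U assume U: "X \<in> U \<and> openin ?X U"
      then obtain r where r: "0 < r" and rU: "\<And>Y. Y \<in> sobolev_right T a b \<alpha> p \<Longrightarrow>
          sobolev_right_norm T a b \<alpha> p (class_diff Y X) < r \<Longrightarrow> Y \<in> U"
        unfolding openin_sobolev_right_topology by blast
      obtain c where c: "c \<in> C" "sobolev_modular \<alpha> p (\<lambda>t. c t - u t) < r powr p"
        using dense[rule_format, OF u(1), of "r powr p"] r by auto
      have "sobolev_right_norm T a b \<alpha> p (class_diff (ae_class T a b c) X)
          = sobolev_modular \<alpha> p (\<lambda>t. c t - u t) powr (1 / p)"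
        using sobolev_right_norm_class_diff[of c \<alpha> p u] c C u p by auto
      also have "\<dots> < (r powr p) powr (1 / p)"
        using c p by (intro powr_less_mono2) (auto simp: sobolev_modular_nonneg)
      also have "\<dots> = r" using r p by (simp add: powr_powr)
      finally have "ae_class T a b c \<in> U" using c C by (intro rU) (auto simp: W)
      then show "\<exists>Y. Y \<in> ae_class T a b ` C \<and> Y \<in> U" using c by blast
    qed
  qed
  moreover have "ae_class T a b ` C \<subseteq> topspace ?X"
    using C by (auto simp: topspace_sobolev_right_topology W)
  ultimately show ?thesis unfolding separable_space_def using C by blast
qed

end

theorem theorem4p8:
  fixes T :: "real set" and a b \<alpha> p :: real
  assumes "T \<noteq> {}" and "closed T"
    and "a \<in> T" and "b \<in> T" and "0 < a" and "a < b"
    and "0 < \<alpha>" and "\<alpha> \<le> 1" and "1 \<le> p"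
  shows "separable_space (sobolev_right_topology T a b \<alpha> p :: (real \<Rightarrow> real ^ 'n) set topology)"
proof -
  interpret time_scale_interval T a b by unfold_locales fact+
  show ?thesis using \<open>1 \<le> p\<close> by (rule separable_sobolev_right)
qed

end
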